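(* Let $q$ be a power of a prime number and, for $n\ge1$, let $Q_n$ be uniformly distributed on the set of the $q^n$ monic polynomials of degree $n$ in $\mathbb F_q[X]$. Let $\omega_q(Q)$ denote the number of monic irreducible divisors of $Q$ counted without multiplicity. Suppose that $(\omega_q(Q_n))_n$ converges in the mod-Poisson sense at speed $\log n$ to a certain function $\Phi_{\omega_q}$, with a speed of convergence given by $$\frac{\mathbb E\big(x^{\omega_q(Q_n)}\big)}{\mathbb E\big(x^{\mathcal P(\log n)}\big)}=\Phi_{\omega_q}(x)\Big(1+O_x\Big(\frac1n\Big)\Big).$$ Define the independent model $$\widehat\omega_{q,n}:=\sum_{P,\ \deg P\le n}B_P,$$ where the sum runs over monic irreducible polynomials $P\in\mathbb F_q[X]$ and the $B_P$ are independent $\{0,1\}$-valued Bernoulli random variables of parameter $1/|P|_q$, with $|P|_q:=q^{\deg P}$. Denote by $\Phi_{\widehat\omega_q}$ the limiting function of $(\widehat\omega_{q,n})_n$, defined by $$\Phi_{\widehat\omega_q}(x):=\prod_{P}\Big(1+\frac{x-1}{|P|_q}\Big)e^{-\frac{x-1}{|P|_q}},$$ the product running over all monic irreducible polynomials $P\in\mathbb F_q[X]$. Then, necessarily, there exists $\kappa\in\mathbb R$ such that $$\Phi_{\omega_q}(x)=\frac{e^{\kappa(x-1)}}{\Gamma(x)}\,\Phi_{\widehat\omega_q}(x).$$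
   Context: $\mathcal P(\lambda)$ is a Poisson random variable of parameter $\lambda$, so $\mathbb E(x^{\mathcal P(\lambda)})=e^{\lambda(x-1)}$. $\Gamma$ is the Gamma function. $O_x(\cdot)$ means that the implied constant may depend on $x$. Mod-Poisson convergence: a sequence $(X_n)_n$ of positive random variables converges in the mod-Poisson sense at speed $(\gamma_n)_n$ (strictly positive reals) to $\Phi$ if $\Phi:\mathbb C\to\mathbb C$ is a continuous function with $\Phi(1)=1$ and $\Phi(\overline z)=\overline{\Phi(z)}$, and $\mathbb E(z^{X_n})/\mathbb E(z^{\mathcal P(\gamma_n)})\to\Phi(z)$ as $n\to\infty$, locally uniformly in $z\in\mathbb C$. *)

theory Defs
  imports
    "HOL-Probability.Probability"
    "HOL-Computational_Algebra.Polynomial_Factorial"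
    "HOL-Library.Landau_Symbols"
begin

text \<open>
  The finite field with q elements is a type \<open>'a :: {field, finite}\<close>, with \<open>q = CARD('a)\<close>.
\<close>

subsection \<open>Mod-Poisson convergence\<close>

text \<open>
  The variables are \<open>nat\<close>-valued, so that \<open>z ^ X n\<close> makes sense for every complex \<open>z\<close>, and
  integrability is required because the Bochner integral of a non-integrable function is 0.
  A speed is only required to be positive from some index on: the speed \<open>ln n\<close> vanishes at
  \<open>n = 1\<close>, and \<open>poisson_pmf r\<close> is specified only for \<open>r > 0\<close>.
\<close>

definition poisson_ratio ::
    "'w measure \<Rightarrow> ('w \<Rightarrow> nat) \<Rightarrow> real \<Rightarrow> complex \<Rightarrow> complex" where
  "poisson_ratio M X r z =
     (\<integral>w. z ^ X w \<partial>M) / measure_pmf.expectation (poisson_pmf r) (\<lambda>k. z ^ k)"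

definition mod_poisson_convergent ::
    "(nat \<Rightarrow> 'w measure) \<Rightarrow> (nat \<Rightarrow> 'w \<Rightarrow> nat) \<Rightarrow> (nat \<Rightarrow> real) \<Rightarrow> (complex \<Rightarrow> complex) \<Rightarrow> bool" where
  "mod_poisson_convergent M X \<gamma> \<Phi> \<longleftrightarrow>
     (\<forall>n. prob_space (M n) \<and> X n \<in> measurable (M n) (count_space UNIV)) \<and>
     (\<forall>n z. integrable (M n) (\<lambda>w. (z::complex) ^ X n w)) \<and>
     (\<forall>\<^sub>F n in sequentially. \<gamma> n > 0) \<and>
     continuous_on UNIV \<Phi> \<and> \<Phi> 1 = 1 \<and> (\<forall>z. \<Phi> (cnj z) = cnj (\<Phi> z)) \<and>
     (\<forall>z. \<exists>r>0. uniform_limit (ball z r) (\<lambda>n. poisson_ratio (M n) (X n) (\<gamma> n)) \<Phi> sequentially)"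

text \<open>
  The speed of convergence, as a relative error \<open>\<Phi> x * (1 + O_x (1 / n))\<close> for each complex \<open>x\<close>. A relative
  error has content only where \<open>\<Phi> x \<noteq> 0\<close>: at a zero of \<open>\<Phi>\<close>, the formula would demand that the ratio
  be exactly 0 for large \<open>n\<close>. Such points are left unconstrained.
\<close>

definition mod_poisson_relative_error ::
    "(nat \<Rightarrow> 'w measure) \<Rightarrow> (nat \<Rightarrow> 'w \<Rightarrow> nat) \<Rightarrow> (nat \<Rightarrow> real) \<Rightarrow> (complex \<Rightarrow> complex) \<Rightarrow> bool" where
  "mod_poisson_relative_error M X \<gamma> \<Phi> \<longleftrightarrow>
     (\<forall>x. \<Phi> x \<noteq> 0 \<longrightarrow>
        (\<exists>\<epsilon> \<in> O(\<lambda>n. 1 / of_nat n). \<forall>\<^sub>F n in sequentially.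
           poisson_ratio (M n) (X n) (\<gamma> n) x = \<Phi> x * (1 + \<epsilon> n)))"

subsection \<open>Monic and irreducible polynomials over a finite field\<close>

definition monic_polys :: "nat \<Rightarrow> 'a :: {field, finite} poly set" where
  "monic_polys n = {Q. lead_coeff Q = 1 \<and> degree Q = n}"

definition monic_irreducibles :: "'a :: {field, finite} poly set" where
  "monic_irreducibles = {P. lead_coeff P = 1 \<and> irreducible P}"

definition poly_abs :: "'a :: {field, finite} poly \<Rightarrow> nat" where
  "poly_abs P = CARD('a) ^ degree P"

definition omega_poly :: "'a :: {field, finite} poly \<Rightarrow> nat" where
  "omega_poly Q = card {P \<in> monic_irreducibles. P dvd Q}"

definition uniform_monic :: "nat \<Rightarrow> 'a :: {field, finite} poly measure" where
  "uniform_monic n = measure_pmf (pmf_of_set (monic_polys n))"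

subsection \<open>The independent model\<close>

text \<open>
  The same \<open>B P\<close> serve for all \<open>n\<close>. The limiting function of this model, \<open>Phi_model\<close> below, belongs to
  the speed \<open>\<Sum>P. 1 / |P|\<close> (\<open>deg P \<le> n\<close>), see \<open>omega_model_mod_poisson\<close> at the end.
\<close>

definition bernoulli_model ::
    "'w measure \<Rightarrow> ('a :: {field, finite} poly \<Rightarrow> 'w \<Rightarrow> nat) \<Rightarrow> bool" where
  "bernoulli_model M B \<longleftrightarrow>
     prob_space M \<and>
     prob_space.indep_vars M (\<lambda>_. count_space UNIV) B monic_irreducibles \<and>
     (\<forall>P\<in>monic_irreducibles. distr M (count_space UNIV) (B P) =
        measure_pmf (map_pmf of_bool (bernoulli_pmf (1 / real (poly_abs P)))))"

definition omega_model :: "('a :: {field, finite} poly \<Rightarrow> 'w \<Rightarrow> nat) \<Rightarrow> nat \<Rightarrow> 'w \<Rightarrow> nat" where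
  "omega_model B n w = (\<Sum>P | P \<in> monic_irreducibles \<and> degree P \<le> n. B P w)"

text \<open>
  The index set of the product carries no order, so the product is the limit of the finite
  products along the net of finite sets of monic irreducibles, as for \<^const>\<open>infsum\<close>.
  The field enters only through the type, which is passed as \<open>TYPE('a)\<close>.
\<close>

definition Phi_model :: "'a :: {field, finite} itself \<Rightarrow> complex \<Rightarrow> complex" where
  "Phi_model _ x =
     Lim (finite_subsets_at_top (monic_irreducibles :: 'a poly set))
       (prod (\<lambda>P. (1 + (x - 1) / of_nat (poly_abs P)) * exp (- ((x - 1) / of_nat (poly_abs P)))))"


subsection \<open>The product is the limiting function of the model\<close>

lemma norm_prod_1_plus_diff_le:
  fixes a :: "'i \<Rightarrow> complex" and m :: "'i \<Rightarrow> real"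
  assumes "finite F" "\<And>i. i \<in> F \<Longrightarrow> norm (a i) \<le> m i"
  shows "norm ((\<Prod>i\<in>F. 1 + a i) - 1) \<le> exp (sum m F) - 1"
  using assms
proof (induction F rule: finite_induct)
  case (insert j F)
  let ?p = "\<Prod>i\<in>F. 1 + a i"
  have "norm (a j) \<le> m j" using insert by auto
  then have m0: "0 \<le> m j" by (meson norm_ge_zero order_trans)
  have IH: "norm (?p - 1) \<le> exp (sum m F) - 1" using insert by auto
  have "(\<Prod>i\<in>insert j F. 1 + a i) - 1 = (1 + a j) * (?p - 1) + a j"
    using insert by (simp add: algebra_simps)
  also have "norm \<dots> \<le> norm (1 + a j) * norm (?p - 1) + norm (a j)"
    by (metis norm_mult norm_triangle_ineq)
  also have "\<dots> \<le> (1 + m j) * (exp (sum m F) - 1) + m j"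
  proof (intro add_mono mult_mono IH)
    show "norm (1 + a j) \<le> 1 + m j"
      using \<open>norm (a j) \<le> m j\<close> norm_triangle_ineq[of 1 "a j"] by simp
  qed (use m0 \<open>norm (a j) \<le> m j\<close> in auto)
  also have "\<dots> = (1 + m j) * exp (sum m F) - 1" by (simp add: algebra_simps)
  also have "\<dots> \<le> exp (m j) * exp (sum m F) - 1"
    using exp_ge_add_one_self[of "m j"] by (simp add: mult_right_mono)
  also have "\<dots> = exp (sum m (insert j F)) - 1" using insert by (simp add: exp_add)
  finally show ?case .
qed simp

lemma uniform_limit_prod_along_finite_sets:
  fixes f :: "'i \<Rightarrow> complex \<Rightarrow> complex" and m :: "'i \<Rightarrow> real"
  assumes m: "m summable_on A"
    and f: "\<And>i z. i \<in> A \<Longrightarrow> z \<in> S \<Longrightarrow> norm (f i z - 1) \<le> m i"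
    and D: "\<And>n. finite (D n)" "incseq D" "(\<Union>n. D n) = A"
  shows "\<exists>g. uniform_limit S (\<lambda>n z. \<Prod>i\<in>D n. f i z) g sequentially \<and>
    (\<forall>z\<in>S. ((\<lambda>F. \<Prod>i\<in>F. f i z) \<longlongrightarrow> g z) (finite_subsets_at_top A))"
proof (cases "S = {}")
  case True
  then show ?thesis by (auto simp: uniform_limit_iff)
next
  case False
  then obtain z0 where z0: "z0 \<in> S" by auto
  have m0: "0 \<le> m i" if "i \<in> A" for i
    using f[OF that z0] by (meson norm_ge_zero order_trans)
  define T where "T = infsum m A"
  have sum_le: "sum m F \<le> T" if "finite F" "F \<subseteq> A" for F
    unfolding T_def using that m m0 by (intro finite_sum_le_infsum) auto
  have core: "norm ((\<Prod>i\<in>G. f i z) - (\<Prod>i\<in>F. f i z)) \<le> exp T * (exp (sum m (G - F)) - 1)"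
    if "finite G" "F \<subseteq> G" "G \<subseteq> A" "z \<in> S" for F G z
  proof -
    have fin: "finite F" "finite (G - F)" using that finite_subset by auto
    have eq: "(\<Prod>i\<in>G. f i z) - (\<Prod>i\<in>F. f i z) = (\<Prod>i\<in>F. f i z) * ((\<Prod>i\<in>G - F. f i z) - 1)"
      using prod.subset_diff[OF that(2,1), of "\<lambda>i. f i z"] by (simp add: algebra_simps)
    have 1: "norm ((\<Prod>i\<in>G - F. f i z) - 1) \<le> exp (sum m (G - F)) - 1"
      using norm_prod_1_plus_diff_le[OF fin(2), of "\<lambda>i. f i z - 1" m] f that by auto
    have "norm ((\<Prod>i\<in>F. f i z) - 1) \<le> exp (sum m F) - 1"
      using norm_prod_1_plus_diff_le[OF fin(1), of "\<lambda>i. f i z - 1" m] f that by auto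
    then have "norm (\<Prod>i\<in>F. f i z) \<le> exp (sum m F)"
      using norm_triangle_ineq2[of "\<Prod>i\<in>F. f i z" 1] by simp
    also have "\<dots> \<le> exp T" using sum_le[of F] fin that by auto
    finally show ?thesis unfolding eq norm_mult using 1 by (intro mult_mono) auto
  qed
  have approx: "\<exists>F0. finite F0 \<and> F0 \<subseteq> A \<and>
      (\<forall>G z. finite G \<longrightarrow> F0 \<subseteq> G \<longrightarrow> G \<subseteq> A \<longrightarrow> z \<in> S \<longrightarrow>
         dist (\<Prod>i\<in>G. f i z) (\<Prod>i\<in>F0. f i z) < e)" if e: "e > 0" for e
  proof -
    have "((\<lambda>d. exp T * (exp d - 1)) \<longlongrightarrow> exp T * (exp 0 - 1)) (at_right (0::real))"
      by (intro tendsto_intros)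
    then have "\<forall>\<^sub>F d in at_right 0. exp T * (exp d - 1) < e"
      using e by (intro order_tendstoD) auto
    moreover have "\<forall>\<^sub>F d in at_right (0::real). d > 0" by (simp add: eventually_at_right_less)
    ultimately have "\<forall>\<^sub>F d in at_right (0::real). exp T * (exp d - 1) < e \<and> d > 0"
      by (rule eventually_conj)
    then obtain d :: real where d: "exp T * (exp d - 1) < e" "d > 0"
      using eventually_happens' trivial_limit_at_right_real by blast
    have "(sum m \<longlongrightarrow> T) (finite_subsets_at_top A)"
      using has_sum_infsum[OF m] by (simp add: has_sum_def T_def)
    then have "\<forall>\<^sub>F F in finite_subsets_at_top A. sum m F > T - d"
      using d(2) by (intro order_tendstoD) auto
    then obtain F0 where F0: "finite F0" "F0 \<subseteq> A" "sum m F0 > T - d"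
      by (auto simp: eventually_finite_subsets_at_top)
    have "dist (\<Prod>i\<in>G. f i z) (\<Prod>i\<in>F0. f i z) < e"
      if G: "finite G" "F0 \<subseteq> G" "G \<subseteq> A" "z \<in> S" for G z
    proof -
      have "sum m (G - F0) \<le> d"
        using sum_le[OF G(1,3)] sum.subset_diff[OF G(2,1), of m] F0(3) by linarith
      then have "exp T * (exp (sum m (G - F0)) - 1) \<le> exp T * (exp d - 1)" by simp
      then show ?thesis using core[OF G] d(1) unfolding dist_norm by linarith
    qed
    with F0 show ?thesis by blast
  qed
  have fin_sub: "\<exists>N. F0 \<subseteq> D N" if "finite F0" "F0 \<subseteq> A" for F0
  proof -
    from that D(3) have "\<forall>i\<in>F0. \<exists>n. i \<in> D n" by blast
    then obtain h where h: "\<And>i. i \<in> F0 \<Longrightarrow> i \<in> D (h i)" by metis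
    have "F0 \<subseteq> D (Max (h ` F0))"
    proof
      fix i assume i: "i \<in> F0"
      then have "h i \<le> Max (h ` F0)" using that(1) by simp
      then show "i \<in> D (Max (h ` F0))" using h[OF i] D(2) incseqD by blast
    qed
    then show ?thesis by blast
  qed
  have D_sub: "D n \<subseteq> A" for n using D(3) by blast
  have "uniformly_Cauchy_on S (\<lambda>n z. \<Prod>i\<in>D n. f i z)"
  proof (rule uniformly_Cauchy_onI)
    fix e :: real assume "e > 0"
    then obtain F0 where F0: "finite F0" "F0 \<subseteq> A"
      and *: "\<And>G z. finite G \<Longrightarrow> F0 \<subseteq> G \<Longrightarrow> G \<subseteq> A \<Longrightarrow> z \<in> S \<Longrightarrow>
                dist (\<Prod>i\<in>G. f i z) (\<Prod>i\<in>F0. f i z) < e / 2"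
      using approx[of "e/2"] by auto
    obtain N where "F0 \<subseteq> D N" using fin_sub[OF F0] by blast
    then have sub: "F0 \<subseteq> D n" if "n \<ge> N" for n using D(2) that by (meson incseqD order_trans)
    show "\<exists>M. \<forall>x\<in>S. \<forall>m\<ge>M. \<forall>n\<ge>M. dist (\<Prod>i\<in>D m. f i x) (\<Prod>i\<in>D n. f i x) < e"
    proof (intro exI[of _ N] ballI allI impI)
      fix x k n assume "x \<in> S" "k \<ge> N" "n \<ge> N"
      then show "dist (\<Prod>i\<in>D k. f i x) (\<Prod>i\<in>D n. f i x) < e"
        using *[OF D(1) sub D_sub, of k x] *[OF D(1) sub D_sub, of n x]
          dist_triangle_half_l[of "\<Prod>i\<in>D k. f i x" "\<Prod>i\<in>F0. f i x" e "\<Prod>i\<in>D n. f i x"]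
        by (simp add: dist_commute)
    qed
  qed
  then obtain g where g: "uniform_limit S (\<lambda>n z. \<Prod>i\<in>D n. f i z) g sequentially"
    using Cauchy_uniformly_convergent uniformly_convergent_on_def by blast
  have "((\<lambda>F. \<Prod>i\<in>F. f i z) \<longlongrightarrow> g z) (finite_subsets_at_top A)" if z: "z \<in> S" for z
  proof (rule tendstoI)
    fix e :: real assume "e > 0"
    then obtain F0 where F0: "finite F0" "F0 \<subseteq> A"
      and *: "\<And>G z. finite G \<Longrightarrow> F0 \<subseteq> G \<Longrightarrow> G \<subseteq> A \<Longrightarrow> z \<in> S \<Longrightarrow>
                dist (\<Prod>i\<in>G. f i z) (\<Prod>i\<in>F0. f i z) < e / 2"
      using approx[of "e/2"] by auto
    obtain N where N: "F0 \<subseteq> D N" using fin_sub[OF F0] by blast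
    have lim: "(\<lambda>n. dist (\<Prod>i\<in>D n. f i z) (\<Prod>i\<in>F0. f i z)) \<longlonglongrightarrow> dist (g z) (\<Prod>i\<in>F0. f i z)"
      by (intro tendsto_intros tendsto_uniform_limitI[OF g z])
    have "dist (g z) (\<Prod>i\<in>F0. f i z) \<le> e / 2"
    proof (rule LIMSEQ_le_const2[OF lim], intro exI[of _ N] allI impI)
      fix n assume "n \<ge> N"
      then have "F0 \<subseteq> D n" using N D(2) by (meson incseqD order_trans)
      then show "dist (\<Prod>i\<in>D n. f i z) (\<Prod>i\<in>F0. f i z) \<le> e / 2"
        using *[OF D(1) _ D_sub z, of n] by simp
    qed
    then have "dist (\<Prod>i\<in>G. f i z) (g z) < e" if "finite G" "F0 \<subseteq> G" "G \<subseteq> A" for G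
      using *[OF that z] dist_triangle2[of "\<Prod>i\<in>G. f i z" "g z" "\<Prod>i\<in>F0. f i z"] by simp
    then show "\<forall>\<^sub>F F in finite_subsets_at_top A. dist (\<Prod>i\<in>F. f i z) (g z) < e"
      unfolding eventually_finite_subsets_at_top using F0 by blast
  qed
  with g show ?thesis by blast
qed

lemma
  shows finite_monic_polys: "finite (monic_polys n :: 'a :: {field, finite} poly set)"
    and card_monic_polys_le: "card (monic_polys n :: 'a poly set) \<le> CARD('a) ^ n"
proof -
  let ?L = "{xs :: 'a list. set xs \<subseteq> UNIV \<and> length xs = n}"
  have inj: "inj_on (\<lambda>P :: 'a poly. map (coeff P) [0..<n]) (monic_polys n)"
  proof (rule inj_onI)
    fix P Q :: "'a poly"
    assume PQ: "P \<in> monic_polys n" "Q \<in> monic_polys n"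
      and eq: "map (coeff P) [0..<n] = map (coeff Q) [0..<n]"
    show "P = Q"
    proof (rule poly_eqI)
      fix i
      from eq have *: "coeff P i = coeff Q i" if "i < n" using that by auto
      show "coeff P i = coeff Q i"
        using PQ * by (cases i n rule: linorder_cases) (auto simp: monic_polys_def coeff_eq_0)
    qed
  qed
  have sub: "(\<lambda>P :: 'a poly. map (coeff P) [0..<n]) ` monic_polys n \<subseteq> ?L" by auto
  have fin: "finite ?L" by (rule finite_lists_length_eq) simp
  show "finite (monic_polys n :: 'a poly set)"
    using inj_on_finite[OF inj sub fin] .
  show "card (monic_polys n :: 'a poly set) \<le> CARD('a) ^ n"
    using card_inj_on_le[OF inj sub fin] card_lists_length_eq[of "UNIV :: 'a set" n] by simp
qed

lemma CARD_field_ge_2: "CARD('a :: {field, finite}) \<ge> 2"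
proof -
  have "card {0, 1 :: 'a} \<le> CARD('a)" by (intro card_mono) auto
  then show ?thesis by simp
qed

lemma poly_abs_ge_1: "poly_abs (P :: 'a :: {field, finite} poly) \<ge> 1"
  using CARD_field_ge_2[where 'a = 'a] by (simp add: poly_abs_def)

lemma summable_poly_abs:
  "(\<lambda>P. 1 / real (poly_abs P) ^ 2) summable_on (monic_irreducibles :: 'a :: {field, finite} poly set)"
proof (rule nonneg_bdd_above_summable_on)
  define q where "q = real CARD('a)"
  have q: "q \<ge> 2" using CARD_field_ge_2[where 'a = 'a] by (simp add: q_def)
  have "(\<Sum>P\<in>F. 1 / real (poly_abs P) ^ 2) \<le> 2"
    if F: "F \<subseteq> monic_irreducibles" "finite F" for F :: "'a poly set"
  proof -
    define N where "N = Max (degree ` F)"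
    have sub: "F \<subseteq> (\<Union>d\<le>N. monic_polys d)"
      using F by (force simp: N_def monic_irreducibles_def monic_polys_def)
    have "(\<Sum>P\<in>F. 1 / real (poly_abs P) ^ 2) \<le>
          (\<Sum>P\<in>(\<Union>d\<le>N. monic_polys d :: 'a poly set). 1 / real (poly_abs P) ^ 2)"
      by (rule sum_mono2[OF _ sub]) (auto simp: finite_monic_polys)
    also have "\<dots> = (\<Sum>d\<le>N. \<Sum>P\<in>(monic_polys d :: 'a poly set). 1 / real (poly_abs P) ^ 2)"
      using finite_monic_polys[where 'a = 'a]
      by (intro sum.UNION_disjoint) (auto simp: monic_polys_def)
    also have "\<dots> = (\<Sum>d\<le>N. real (card (monic_polys d :: 'a poly set)) * (1 / (q ^ d) ^ 2))"
      by (intro sum.cong) (auto simp: monic_polys_def poly_abs_def q_def)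
    also have "\<dots> \<le> (\<Sum>d\<le>N. q ^ d * (1 / (q ^ d) ^ 2))"
    proof (intro sum_mono mult_right_mono)
      fix d
      have "real (card (monic_polys d :: 'a poly set)) \<le> real (CARD('a) ^ d)"
        using card_monic_polys_le by (simp only: of_nat_le_iff)
      then show "real (card (monic_polys d :: 'a poly set)) \<le> q ^ d" by (simp add: q_def)
    qed auto
    also have "\<dots> = (\<Sum>d\<le>N. (1 / q) ^ d)"
      using q by (intro sum.cong) (auto simp: power2_eq_square field_simps)
    also have "\<dots> \<le> (\<Sum>d\<le>N. (1 / 2) ^ d)"
      using q by (intro sum_mono power_mono) auto
    also have "\<dots> \<le> (\<Sum>d. (1 / 2 :: real) ^ d)"
      by (intro sum_le_suminf) auto
    also have "\<dots> = 2" by (simp add: suminf_geometric)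
    finally show ?thesis .
  qed
  then show "bdd_above (sum (\<lambda>P. 1 / real (poly_abs P) ^ 2) `
      {F. F \<subseteq> (monic_irreducibles :: 'a poly set) \<and> finite F})"
    by (intro bdd_aboveI[of _ 2]) auto
qed auto

lemma norm_mod_poisson_factor_le:
  fixes w :: complex
  assumes "norm w \<le> R"
  shows "norm ((1 + w) * exp (- w) - 1) \<le> ((1 + R) * exp R + 1) * norm w ^ 2"
proof -
  have R: "R \<ge> 0" using assms norm_ge_zero order_trans by blast
  have "norm (exp (- w) - (\<Sum>k\<le>1. (- w) ^ k / fact k)) \<le> exp (norm (- w)) * norm (- w) ^ Suc 1 / fact 1"
    by (rule Taylor_exp_field)
  then have e: "norm (exp (- w) - 1 + w) \<le> exp (norm w) * norm w ^ 2"
    by (simp add: power2_eq_square algebra_simps)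
  have "(1 + w) * exp (- w) - 1 = (1 + w) * (exp (- w) - 1 + w) - w ^ 2"
    by (simp add: algebra_simps power2_eq_square)
  also have "norm \<dots> \<le> norm (1 + w) * norm (exp (- w) - 1 + w) + norm w ^ 2"
    by (metis norm_mult norm_power norm_triangle_ineq4)
  also have "\<dots> \<le> (1 + R) * (exp R * norm w ^ 2) + norm w ^ 2"
  proof (intro add_mono mult_mono order.refl)
    show "norm (1 + w) \<le> 1 + R" using assms norm_triangle_ineq[of 1 w] by simp
    have "exp (norm w) * norm w ^ 2 \<le> exp R * norm w ^ 2"
      using assms by (intro mult_right_mono) auto
    with e show "norm (exp (- w) - 1 + w) \<le> exp R * norm w ^ 2" by linarith
  qed (use R in auto)
  also have "\<dots> = ((1 + R) * exp R + 1) * norm w ^ 2" by (simp add: algebra_simps)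
  finally show ?thesis .
qed

lemma expectation_poisson_power:
  assumes "r > 0"
  shows "measure_pmf.expectation (poisson_pmf r) (\<lambda>k. z ^ k) = exp (of_real r * (z - 1 :: complex))"
proof -
  have eq: "pmf (poisson_pmf r) k *\<^sub>R z ^ k = of_real (exp (- r)) * ((of_real r * z) ^ k /\<^sub>R fact k)" for k
    using assms by (simp add: scaleR_conv_of_real power_mult_distrib field_simps)
  have "summable (\<lambda>k. norm (pmf (poisson_pmf r) k *\<^sub>R z ^ k))"
    unfolding eq norm_mult by (intro summable_mult summable_norm_exp)
  then have "integrable (count_space UNIV) (\<lambda>k. pmf (poisson_pmf r) k *\<^sub>R z ^ k)"
    by (simp add: integrable_count_space_nat_iff)
  then have "(\<integral>k. pmf (poisson_pmf r) k *\<^sub>R z ^ k \<partial>count_space UNIV) =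
      (\<Sum>k. pmf (poisson_pmf r) k *\<^sub>R z ^ k)"
    by (rule integral_count_space_nat)
  also have "\<dots> = of_real (exp (- r)) * exp (of_real r * z)"
    unfolding eq exp_def by (intro suminf_mult summable_exp_generic)
  also have "\<dots> = exp (of_real r * (z - 1))"
    by (simp add: exp_of_real exp_add[symmetric] algebra_simps flip: exp_of_real)
  finally show ?thesis
    unfolding measure_pmf_eq_density by (subst integral_density) auto
qed

lemma bernoulli_model_expectation:
  fixes B :: "'a :: {field, finite} poly \<Rightarrow> 'w \<Rightarrow> nat" and z :: complex
  assumes "bernoulli_model M B"
  shows "(\<integral>w. z ^ omega_model B n w \<partial>M) =
           (\<Prod>P | P \<in> (monic_irreducibles :: 'a poly set) \<and> degree P \<le> n. 1 + (z - 1) / of_nat (poly_abs P))"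
    and "integrable M (\<lambda>w. z ^ omega_model B n w)"
    and "omega_model B n \<in> measurable M (count_space UNIV)"
proof -
  interpret prob_space M using assms by (simp add: bernoulli_model_def)
  define I where "I = {P :: 'a poly. P \<in> monic_irreducibles \<and> degree P \<le> n}"
  have "I \<subseteq> (\<Union>d\<le>n. monic_polys d)" by (auto simp: I_def monic_irreducibles_def monic_polys_def)
  then have finI: "finite I" by (rule finite_subset) (auto intro: finite_monic_polys)
  have ind: "indep_vars (\<lambda>_. count_space UNIV) B I"
    using assms by (auto simp: bernoulli_model_def I_def intro: indep_vars_subset)
  then have meas: "B P \<in> measurable M (count_space UNIV)" if "P \<in> I" for P
    using that by (simp add: indep_vars_def)
  show "omega_model B n \<in> measurable M (count_space UNIV)"
    using meas unfolding omega_model_def[abs_def] I_def[symmetric] by measurable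
  have pw: "z ^ omega_model B n w = (\<Prod>P\<in>I. z ^ B P w)" for w
    by (simp add: omega_model_def I_def power_sum)
  have ind': "indep_vars (\<lambda>_. borel) (\<lambda>P w. z ^ B P w) I"
    by (rule indep_vars_compose2[OF ind]) simp
  have distr: "distr M (count_space UNIV) (B P) =
      measure_pmf (map_pmf of_bool (bernoulli_pmf (1 / real (poly_abs P))))" if "P \<in> I" for P
    using assms that by (simp add: bernoulli_model_def I_def)
  have int: "integrable M (\<lambda>w. z ^ B P w)" if "P \<in> I" for P
  proof -
    have "integrable (measure_pmf (map_pmf of_bool (bernoulli_pmf (1 / real (poly_abs P))))) (\<lambda>k::nat. z ^ k)"
      by (intro integrable_measure_pmf_finite) auto
    then show ?thesis
      unfolding distr[OF that, symmetric] using meas[OF that] by (subst (asm) integrable_distr_eq) auto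
  qed
  have ex: "(\<integral>w. z ^ B P w \<partial>M) = 1 + (z - 1) / of_nat (poly_abs P)" if "P \<in> I" for P
  proof -
    have p: "1 / real (poly_abs P) \<le> 1" using poly_abs_ge_1[of P] by simp
    have "(\<integral>w. z ^ B P w \<partial>M) = (\<integral>k. z ^ k \<partial>distr M (count_space UNIV) (B P))"
      using meas[OF that] by (subst integral_distr) auto
    also have "\<dots> = (\<integral>b. z ^ (of_bool b :: nat) \<partial>measure_pmf (bernoulli_pmf (1 / real (poly_abs P))))"
      unfolding distr[OF that] by simp
    also have "\<dots> = 1 + (z - 1) / of_nat (poly_abs P)"
      using p by (subst integral_measure_pmf[of UNIV])
        (auto simp: UNIV_bool scaleR_conv_of_real algebra_simps diff_divide_distrib)
    finally show ?thesis .
  qed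
  show "integrable M (\<lambda>w. z ^ omega_model B n w)"
    unfolding pw by (rule indep_vars_integrable[OF finI ind' int])
  show "(\<integral>w. z ^ omega_model B n w \<partial>M) =
      (\<Prod>P | P \<in> (monic_irreducibles :: 'a poly set) \<and> degree P \<le> n.
         1 + (z - 1) / of_nat (poly_abs P))"
    unfolding pw I_def[symmetric]
    using indep_vars_lebesgue_integral[OF finI ind' int] prod.cong[OF refl ex, of I "\<lambda>P. P"] by simp
qed

theorem omega_model_mod_poisson:
  fixes B :: "'a :: {field, finite} poly \<Rightarrow> 'w \<Rightarrow> nat"
  assumes B: "bernoulli_model M B"
  shows "mod_poisson_convergent (\<lambda>_. M) (omega_model B)
           (\<lambda>n. \<Sum>P | P \<in> (monic_irreducibles :: 'a poly set) \<and> degree P \<le> n. 1 / real (poly_abs P))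
           (Phi_model TYPE('a))"
proof -
  define A where "A = (monic_irreducibles :: 'a poly set)"
  define D where "D n = {P. P \<in> A \<and> degree P \<le> n}" for n
  define f where "f P z = (1 + (z - 1) / of_nat (poly_abs P)) * exp (- ((z - 1) / of_nat (poly_abs P)))"
    for P :: "'a poly" and z :: complex
  define \<gamma> where "\<gamma> n = (\<Sum>P\<in>D n. 1 / real (poly_abs P))" for n
  have Phi: "Phi_model TYPE('a) z = Lim (finite_subsets_at_top A) (\<lambda>F. \<Prod>P\<in>F. f P z)" for z
    by (simp add: Phi_model_def A_def f_def)
  have "D n \<subseteq> (\<Union>d\<le>n. monic_polys d)" for n
    by (auto simp: D_def A_def monic_irreducibles_def monic_polys_def)
  then have finD: "finite (D n)" for n
    by (rule finite_subset) (auto intro: finite_monic_polys)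
  have D: "incseq D" "(\<Union>n. D n) = A" by (auto simp: D_def incseq_def)

  have unif: "uniform_limit (ball 0 R) (\<lambda>n z. \<Prod>P\<in>D n. f P z) (Phi_model TYPE('a)) sequentially"
    and lim: "\<And>z. z \<in> ball 0 R \<Longrightarrow>
      ((\<lambda>F. \<Prod>P\<in>F. f P z) \<longlongrightarrow> Phi_model TYPE('a) z) (finite_subsets_at_top A)" for R
  proof -
    define C where "C = ((1 + (R + 1)) * exp (R + 1) + 1) * (R + 1) ^ 2"
    have bound: "norm (f P z - 1) \<le> C * (1 / real (poly_abs P) ^ 2)" if "z \<in> ball 0 R" for P z
    proof -
      define w where "w = (z - 1) / of_nat (poly_abs P)"
      have nz: "norm (z - 1) \<le> R + 1" using that norm_triangle_ineq4[of z 1] by simp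
      have pa: "real (poly_abs P) \<ge> 1" using poly_abs_ge_1[of P] by linarith
      have nw: "norm w = norm (z - 1) / real (poly_abs P)" by (simp add: w_def norm_divide)
      have R: "R + 1 \<ge> 0" using nz norm_ge_zero order_trans by blast
      have "norm (z - 1) / real (poly_abs P) \<le> norm (z - 1) / 1"
        using pa by (intro divide_left_mono) auto
      then have "norm w \<le> R + 1" using nz nw by simp
      then have "norm ((1 + w) * exp (- w) - 1) \<le> ((1 + (R + 1)) * exp (R + 1) + 1) * norm w ^ 2"
        by (rule norm_mod_poisson_factor_le)
      also have "\<dots> \<le> ((1 + (R + 1)) * exp (R + 1) + 1) * ((R + 1) / real (poly_abs P)) ^ 2"
        using nz R pa unfolding nw by (intro mult_left_mono power_mono divide_right_mono) auto
      finally show ?thesis by (simp add: C_def f_def w_def power_divide)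
    qed
    have "(\<lambda>P. C * (1 / real (poly_abs P) ^ 2)) summable_on A"
      unfolding A_def by (intro summable_on_cmult_right summable_poly_abs)
    from uniform_limit_prod_along_finite_sets[OF this, of "ball 0 R" f D, OF bound finD D]
    obtain g where g: "uniform_limit (ball 0 R) (\<lambda>n z. \<Prod>P\<in>D n. f P z) g sequentially"
      "\<And>z. z \<in> ball 0 R \<Longrightarrow> ((\<lambda>F. \<Prod>P\<in>F. f P z) \<longlongrightarrow> g z) (finite_subsets_at_top A)"
      by blast
    have gPhi: "g z = Phi_model TYPE('a) z" if "z \<in> ball 0 R" for z
      unfolding Phi using g(2)[OF that] by (intro tendsto_Lim[symmetric]) auto
    show "uniform_limit (ball 0 R) (\<lambda>n z. \<Prod>P\<in>D n. f P z) (Phi_model TYPE('a)) sequentially"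
      using g(1) gPhi by (subst uniform_limit_cong'[of _ _ _ _ g]) auto
    show "((\<lambda>F. \<Prod>P\<in>F. f P z) \<longlongrightarrow> Phi_model TYPE('a) z) (finite_subsets_at_top A)"
      if "z \<in> ball 0 R" for z using g(2)[OF that] gPhi[OF that] by simp
  qed
  have in_ball: "z \<in> ball 0 (norm z + 1)" for z :: complex by simp
  have lim': "(\<lambda>n. \<Prod>P\<in>D n. f P z) \<longlonglongrightarrow> Phi_model TYPE('a) z" for z
    by (rule tendsto_uniform_limitI[OF unif in_ball])

  have pos: "\<gamma> n > 0" if "n \<ge> 1" for n
  proof -
    have "irreducible [:0, 1 :: 'a:]"
      by (intro irreducible_linear_field_poly) auto
    then have "[:0, 1:] \<in> D n" using that by (simp add: D_def A_def monic_irreducibles_def)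
    moreover have "1 / real (poly_abs P) > 0" for P :: "'a poly" using poly_abs_ge_1[of P] by simp
    ultimately show ?thesis unfolding \<gamma>_def by (intro sum_pos finD) auto
  qed
  have ratio: "poisson_ratio M (omega_model B n) (\<gamma> n) z = (\<Prod>P\<in>D n. f P z)" if "n \<ge> 1" for n z
  proof -
    have "of_real (\<gamma> n) * (z - 1) = (\<Sum>P\<in>D n. (z - 1) / of_nat (poly_abs P))"
      by (simp add: \<gamma>_def sum_distrib_right)
    then have "exp (of_real (\<gamma> n) * (z - 1)) = (\<Prod>P\<in>D n. exp ((z - 1) / of_nat (poly_abs P)))"
      by (simp add: exp_sum finD)
    then show ?thesis
      unfolding poisson_ratio_def expectation_poisson_power[OF pos[OF that]]
        bernoulli_model_expectation(1)[OF B] f_def prod.distrib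
      by (simp add: D_def A_def exp_minus prod_inversef[symmetric] divide_inverse)
  qed

  have "continuous_on UNIV (Phi_model TYPE('a))"
  proof -
    have "isCont (Phi_model TYPE('a)) z" for z
    proof -
      have "continuous_on (ball 0 (norm z + 1)) (Phi_model TYPE('a))"
        by (rule uniform_limit_theorem[OF _ unif])
          (auto simp: f_def poly_abs_def intro!: always_eventually continuous_intros)
      then show ?thesis using in_ball[of z] by (simp add: continuous_on_eq_continuous_at)
    qed
    then show ?thesis by (simp add: continuous_on_eq_continuous_at)
  qed
  moreover have "Phi_model TYPE('a) 1 = 1"
    using lim'[of 1] by (simp add: f_def LIMSEQ_const_iff)
  moreover have "Phi_model TYPE('a) (cnj z) = cnj (Phi_model TYPE('a) z)" for z
  proof -
    have "cnj (f P z) = f P (cnj z)" for P by (simp add: f_def exp_cnj)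
    then have "(\<lambda>n. \<Prod>P\<in>D n. f P (cnj z)) \<longlonglongrightarrow> cnj (Phi_model TYPE('a) z)"
      using tendsto_cnj[OF lim'[of z]] by simp
    then show ?thesis using lim'[of "cnj z"] LIMSEQ_unique by blast
  qed
  moreover have "\<exists>r>0. uniform_limit (ball z r) (\<lambda>n. poisson_ratio M (omega_model B n) (\<gamma> n))
      (Phi_model TYPE('a)) sequentially" for z
  proof (intro exI[of _ 1] conjI)
    have "ball z 1 \<subseteq> ball 0 (norm z + 1)"
    proof
      fix x assume "x \<in> ball z 1"
      then show "x \<in> ball 0 (norm z + 1)"
        using norm_triangle_sub[of x z] by (simp add: dist_norm norm_minus_commute)
    qed
    with unif have "uniform_limit (ball z 1) (\<lambda>n z. \<Prod>P\<in>D n. f P z) (Phi_model TYPE('a)) sequentially"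
      by (rule uniform_limit_on_subset)
    moreover have "\<forall>\<^sub>F n in sequentially. \<forall>x\<in>ball z 1.
        (\<Prod>P\<in>D n. f P x) = poisson_ratio M (omega_model B n) (\<gamma> n) x"
      using ratio by (auto simp: eventually_sequentially intro!: exI[of _ 1])
    ultimately show "uniform_limit (ball z 1) (\<lambda>n. poisson_ratio M (omega_model B n) (\<gamma> n))
        (Phi_model TYPE('a)) sequentially"
      by (subst (asm) uniform_limit_cong) auto
  qed simp
  moreover have "\<forall>\<^sub>F n in sequentially. \<gamma> n > 0"
    using pos by (auto simp: eventually_sequentially intro!: exI[of _ 1])
  moreover have "prob_space M" using B by (simp add: bernoulli_model_def)
  ultimately have "mod_poisson_convergent (\<lambda>_. M) (omega_model B) \<gamma> (Phi_model TYPE('a))"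
    unfolding mod_poisson_convergent_def using bernoulli_model_expectation(2,3)[OF B] by blast
  then show ?thesis by (simp add: \<gamma>_def[abs_def] D_def A_def)
qed

end

theory Submission
  imports Defs "HOL-Complex_Analysis.Conformal_Mappings" "HOL-Real_Asymp.Real_Asymp"
begin

text \<open>
  Both sides of the asserted identity are entire functions of \<open>x\<close>: \<open>\<Phi>\<close> and the model function are
  locally uniform limits of entire functions (\<open>mod_poisson_limit_holomorphic\<close>), and the reciprocal
  of \<open>Gamma\<close> is entire. By the identity theorem it suffices to prove it for real \<open>x\<close> in \<open>(0, 1]\<close>.

  For such \<open>x\<close>, let \<open>A\<close> be the power series whose coefficients are the expectations of
  \<open>x ^ omega_poly Q\<close> for \<open>Q\<close> uniform among the monic polynomials of degree \<open>n\<close>. The limit of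
  \<open>(1 - t) powr x * A t\<close> as \<open>t\<close> increases to 1 can be evaluated in two ways.

  As \<open>\<Phi> x\<close> is known to exist, the coefficients of \<open>A\<close> are asymptotic to \<open>\<Phi> x * n powr (x - 1)\<close>, and an
  Abelian theorem (\<open>abel_power_singularity\<close>) gives the limit \<open>\<Phi> x * Gamma x\<close>.

  On the other hand, unique factorisation turns \<open>A\<close> into an Euler product (\<open>euler_product\<close>). For
  \<open>x = 1\<close> this is the zeta function \<open>1 / (1 - t)\<close> of \<open>F_q[X]\<close>, so \<open>(1 - t) powr x * A t\<close> is the
  product of the local factors of \<open>A\<close> divided by the \<open>x\<close>-th powers of the local factors of zeta.
  These quotients are \<open>1 + O(1 / |P|\<^sup>2)\<close> uniformly for \<open>t\<close> in \<open>[0, 1]\<close>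
  (\<open>regular_factor_bounds\<close>), so the product is continuous up to \<open>t = 1\<close>
  (\<open>regular_product_at_1_eq_limit\<close>). Its value there is
  \<open>\<Prod>P. (1 + (x - 1) / |P|) * (1 - 1 / |P|) powr (x - 1)\<close>, which is the model function times
  \<open>exp (\<kappa> * (x - 1))\<close> with \<open>\<kappa> = (\<Sum>P. ln (1 - 1 / |P|) + 1 / |P|)\<close>
  (\<open>regular_product_at_1_tendsto_model\<close>).
\<close>

section \<open>Factorisation into monic irreducibles\<close>

definition monic_prime_divisors :: "'a :: {field, finite} poly \<Rightarrow> 'a poly set" where
  "monic_prime_divisors Q = {P \<in> monic_irreducibles. P dvd Q}"

definition monics_over :: "'a :: {field, finite} poly set \<Rightarrow> 'a poly set" where
  "monics_over F = {Q. lead_coeff Q = 1 \<and> monic_prime_divisors Q \<subseteq> F}"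

definition irreducibles_upto :: "nat \<Rightarrow> 'a :: {field, finite} poly set" where
  "irreducibles_upto n = {P. P \<in> monic_irreducibles \<and> degree P \<le> n}"

lemma finite_irreducibles_upto: "finite (irreducibles_upto n :: 'a :: {field, finite} poly set)"
proof (rule finite_subset)
  show "irreducibles_upto n \<subseteq> (\<Union>d\<le>n. monic_polys d :: 'a poly set)"
    by (auto simp: irreducibles_upto_def monic_irreducibles_def monic_polys_def)
qed (auto intro: finite_monic_polys)

lemma irreducibles_upto_subset: "irreducibles_upto n \<subseteq> monic_irreducibles"
  by (auto simp: irreducibles_upto_def)

lemma incseq_irreducibles_upto: "incseq irreducibles_upto"
  by (auto simp: irreducibles_upto_def incseq_def)

lemma UN_irreducibles_upto: "(\<Union>n. irreducibles_upto n) = monic_irreducibles"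
  by (auto simp: irreducibles_upto_def)

lemma omega_poly_eq: "omega_poly Q = card (monic_prime_divisors Q)"
  by (simp add: omega_poly_def monic_prime_divisors_def)

lemma monic_irreducibleD:
  assumes "P \<in> monic_irreducibles"
  shows "lead_coeff P = 1" "prime_elem P" "\<not> is_unit P" "P \<noteq> 0" "degree P > 0"
proof -
  show "lead_coeff P = 1" "prime_elem P"
    using assms by (auto simp: monic_irreducibles_def intro: field_poly_irreducible_imp_prime)
  then show "\<not> is_unit P" "P \<noteq> 0" by (auto simp: prime_elem_def)
  then show "degree P > 0" using is_unit_iff_degree[of P] by simp
qed

lemma finite_monic_prime_divisors:
  fixes Q :: "'a :: {field, finite} poly"
  assumes "Q \<noteq> 0"
  shows "finite (monic_prime_divisors Q)"
proof (rule finite_subset)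
  show "monic_prime_divisors Q \<subseteq> irreducibles_upto (degree Q)"
    using assms by (auto simp: monic_prime_divisors_def irreducibles_upto_def dvd_imp_degree_le)
qed (rule finite_irreducibles_upto)

lemma monic_irreducible_dvd_imp_eq:
  assumes P: "P \<in> monic_irreducibles" and R: "R \<in> monic_irreducibles" and "R dvd P"
  shows "R = P"
proof -
  obtain c where c: "P = R * c" using \<open>R dvd P\<close> by auto
  have "irreducible P" using P by (simp add: monic_irreducibles_def)
  then have "is_unit c" using irreducibleD[OF _ c] monic_irreducibleD(3)[OF R] by blast
  then have "degree c = 0" using is_unit_iff_degree[of c] by (cases "c = 0") auto
  moreover have "lead_coeff c = 1"
    using monic_irreducibleD(1)[OF P] monic_irreducibleD(1)[OF R] c
    by (simp add: lead_coeff_mult)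
  ultimately have "c = 1" by (auto simp: one_pCons elim!: degree_eq_zeroE)
  then show ?thesis using c by simp
qed

lemma dvd_power_mult_iff:
  assumes "P \<in> monic_irreducibles" and R: "R \<in> monic_irreducibles"
  shows "R dvd P ^ k * Q \<longleftrightarrow> (k > 0 \<and> R = P) \<or> R dvd Q"
proof -
  have "R dvd P ^ k \<longleftrightarrow> k > 0 \<and> R = P"
    using monic_irreducible_dvd_imp_eq[OF assms] prime_elem_dvd_power[OF monic_irreducibleD(2)[OF R]]
      monic_irreducibleD(3)[OF R] by (cases "k = 0") (auto simp: dvd_power)
  then show ?thesis by (simp add: prime_elem_dvd_mult_iff[OF monic_irreducibleD(2)[OF R]])
qed

lemma monic_prime_divisors_power_mult:
  assumes "P \<in> monic_irreducibles"
  shows "monic_prime_divisors (P ^ k * Q) = (if k = 0 then {} else {P}) \<union> monic_prime_divisors Q"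
  using dvd_power_mult_iff[OF assms] assms by (auto simp: monic_prime_divisors_def)

text \<open>
  A divisor of least positive degree is irreducible, and dividing it by its leading coefficient
  makes it monic.
\<close>

lemma ex_monic_irreducible_dvd:
  fixes Q :: "'a :: {field, finite} poly"
  assumes "degree Q > 0"
  shows "\<exists>P \<in> monic_irreducibles. P dvd Q"
proof -
  have "degree Q > 0 \<and> Q dvd Q" using assms by simp
  from ex_has_least_nat[of "\<lambda>P. degree P > 0 \<and> P dvd Q", OF this, of degree]
  obtain P where P: "degree P > 0" "P dvd Q"
    and least: "\<And>R. degree R > 0 \<Longrightarrow> R dvd Q \<Longrightarrow> degree P \<le> degree R" by auto
  have P0: "P \<noteq> 0" using P by auto
  have irr: "irreducible P"
  proof (rule irreducibleI)
    show "\<not> is_unit P" using P is_unit_iff_degree[OF P0] by simp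
    fix a b assume ab: "P = a * b"
    then have nz: "a \<noteq> 0" "b \<noteq> 0" using P0 by auto
    have "a dvd Q" using ab P by (meson dvd_mult_left)
    then have "degree a = 0 \<or> degree b = 0"
      using least[of a] nz ab by (cases "degree a > 0") (auto simp: degree_mult_eq)
    then show "is_unit a \<or> is_unit b" using nz is_unit_iff_degree by blast
  qed (use P0 in auto)
  define c where "c = inverse (lead_coeff P)"
  have c: "c \<noteq> 0" "[:c:] dvd 1" using P0 by (auto simp: c_def is_unit_const_poly_iff dvd_field_iff)
  have eq: "smult c P = [:c:] * P" by simp
  have "irreducible (smult c P)" unfolding eq using irr c(2) by (subst irreducible_mult_unit_left) auto
  moreover have "lead_coeff (smult c P) = 1" using P0 by (simp add: c_def lead_coeff_smult)
  moreover have "smult c P dvd Q" using P(2) c(1) by (simp add: smult_dvd_iff)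
  ultimately show ?thesis unfolding monic_irreducibles_def by blast
qed

lemma ex_power_decomposition:
  fixes P R :: "'a :: field poly"
  assumes "degree P > 0" "R \<noteq> 0"
  shows "\<exists>k y. R = P ^ k * y \<and> \<not> P dvd y"
  using assms(2)
proof (induction "degree R" arbitrary: R rule: less_induct)
  case less
  show ?case
  proof (cases "P dvd R")
    case True
    then obtain S where S: "R = P * S" by auto
    then have "degree S < degree R" "S \<noteq> 0"
      using less.prems assms(1) by (auto simp: degree_mult_eq)
    then obtain k y where "S = P ^ k * y" "\<not> P dvd y" using less.hyps by blast
    then show ?thesis using S by (intro exI[of _ "Suc k"] exI[of _ y]) (simp add: mult.assoc)
  next
    case False
    then show ?thesis by (intro exI[of _ 0] exI[of _ R]) simp
  qed
qed

lemma monics_over_empty: "monics_over {} = {1 :: 'a :: {field, finite} poly}"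
proof -
  have "Q = 1" if "Q \<in> monics_over {}" for Q :: "'a poly"
  proof -
    have "degree Q = 0"
      using that ex_monic_irreducible_dvd[of Q]
      by (auto simp: monics_over_def monic_prime_divisors_def)
    then show ?thesis
      using that by (auto simp: monics_over_def one_pCons elim!: degree_eq_zeroE)
  qed
  moreover have "(1 :: 'a poly) \<in> monics_over {}"
    using monic_irreducibleD(3) by (auto simp: monics_over_def monic_prime_divisors_def)
  ultimately show ?thesis by blast
qed

text \<open>
  Unique factorisation, one prime at a time: surjectivity is the existence of the
  factorisation \<open>R = P ^ k * Q\<close> with \<open>P\<close> not dividing \<open>Q\<close>, injectivity its uniqueness. Induction
  over a finite set \<open>F\<close> of primes then produces an Euler product with one factor for each prime.
\<close>

lemma bij_betw_monics_over_insert: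
  fixes P :: "'a :: {field, finite} poly"
  assumes P: "P \<in> monic_irreducibles" "P \<notin> F"
  shows "bij_betw (\<lambda>(k, Q). P ^ k * Q) (UNIV \<times> monics_over F) (monics_over (insert P F))"
  unfolding bij_betw_def
proof
  note Pd = monic_irreducibleD[OF P(1)]
  have ndvd: "\<not> P dvd Q" if "Q \<in> monics_over F" for Q
    using that P by (auto simp: monics_over_def monic_prime_divisors_def)
  have le: "k \<le> l" if "R \<in> monics_over F" "P ^ k * Q = P ^ l * R" for k l Q R
  proof (rule ccontr)
    assume "\<not> k \<le> l"
    then have "k = l + Suc (k - Suc l)" by simp
    then have "P ^ k = P ^ l * (P * P ^ (k - Suc l))" by (metis power_add power_Suc)
    then have "P ^ l * (P * (P ^ (k - Suc l) * Q)) = P ^ l * R"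
      using that(2) by (simp only: mult.assoc)
    then have "P * (P ^ (k - Suc l) * Q) = R" using Pd(4) by simp
    then show False using ndvd[OF that(1)] by auto
  qed
  show "inj_on (\<lambda>(k, Q). P ^ k * Q) (UNIV \<times> monics_over F)"
  proof (rule inj_onI, clarify)
    fix k l Q R assume "Q \<in> monics_over F" "R \<in> monics_over F" and eq: "P ^ k * Q = P ^ l * R"
    then have "k = l" using le by (metis order_antisym)
    then show "k = l \<and> Q = R" using eq Pd(4) by simp
  qed
  show "(\<lambda>(k, Q). P ^ k * Q) ` (UNIV \<times> monics_over F) = monics_over (insert P F)"
  proof
    show "(\<lambda>(k, Q). P ^ k * Q) ` (UNIV \<times> monics_over F) \<subseteq> monics_over (insert P F)"
      using Pd(1) by (auto simp: monics_over_def monic_prime_divisors_power_mult[OF P(1)]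
          lead_coeff_mult lead_coeff_power split: if_splits)
    show "monics_over (insert P F) \<subseteq> (\<lambda>(k, Q). P ^ k * Q) ` (UNIV \<times> monics_over F)"
    proof
      fix R assume R: "R \<in> monics_over (insert P F)"
      then have R0: "R \<noteq> 0" by (auto simp: monics_over_def)
      obtain k y where Rk: "R = P ^ k * y" and y: "\<not> P dvd y"
        using ex_power_decomposition[OF Pd(5) R0] by blast
      have "lead_coeff y = 1"
        using R Pd(1) unfolding Rk by (simp add: monics_over_def lead_coeff_mult lead_coeff_power)
      moreover have "monic_prime_divisors y \<subseteq> F"
        using R y unfolding Rk monics_over_def monic_prime_divisors_power_mult[OF P(1)]
        by (auto simp: monic_prime_divisors_def)
      ultimately have "y \<in> monics_over F" by (simp add: monics_over_def)
      then show "R \<in> (\<lambda>(k, Q). P ^ k * Q) ` (UNIV \<times> monics_over F)"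
        by (auto intro!: image_eqI[of _ _ "(k, y)"] simp: Rk)
    qed
  qed
qed

section \<open>The Euler product\<close>

text \<open>
  The local factor at a prime \<open>P\<close>, with \<open>u = s ^ degree P\<close>: the summand of index \<open>k\<close> is the weight of
  \<open>P ^ k\<close>. As \<open>omega_poly\<close> counts without multiplicity, every \<open>k > 0\<close> carries the same factor \<open>x\<close>.
\<close>

lemma has_sum_euler_factor:
  fixes x u :: real
  assumes "0 \<le> x" "0 \<le> u" "u < 1"
  shows "((\<lambda>k. if k = 0 then 1 else x * u ^ k) has_sum (1 + x * u / (1 - u))) UNIV"
proof (rule sums_nonneg_imp_has_sum)
  have "(\<lambda>k. x * u * u ^ k) sums (x * u * (1 / (1 - u)))"
    using assms by (intro sums_mult geometric_sums) auto
  then have "(\<lambda>k. if Suc k = 0 then 1 else x * u ^ Suc k) sums (x * u / (1 - u))"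
    by (simp add: mult.assoc)
  from sums_Suc[OF this]
  show "(\<lambda>k. if k = 0 then 1 else x * u ^ k) sums (1 + x * u / (1 - u))" by (simp add: add.commute)
qed (use assms in auto)

text \<open>
  The weight \<open>x ^ omega_poly Q * s ^ degree Q\<close> is multiplicative on coprime polynomials, so that
  admitting one more prime multiplies the sum by the local factor of that prime.
\<close>

lemma has_sum_monics_over:
  fixes F :: "'a :: {field, finite} poly set" and x s :: real
  assumes "finite F" "F \<subseteq> monic_irreducibles" and x: "0 \<le> x" and s: "0 \<le> s" "s < 1"
  shows "((\<lambda>Q. x ^ omega_poly Q * s ^ degree Q) has_sum
           (\<Prod>P\<in>F. 1 + x * s ^ degree P / (1 - s ^ degree P))) (monics_over F)"
  using assms(1,2)
proof (induction F rule: finite_induct)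
  case empty
  have "omega_poly (1 :: 'a poly) = 0"
  proof -
    have "(1 :: 'a poly) \<in> monics_over {}" by (simp add: monics_over_empty)
    then have "monic_prime_divisors (1 :: 'a poly) = {}" unfolding monics_over_def by blast
    then show ?thesis by (simp add: omega_poly_eq)
  qed
  then show ?case
    using has_sum_finite[of "{1 :: 'a poly}" "\<lambda>Q. x ^ omega_poly Q * s ^ degree Q"]
    by (simp add: monics_over_empty)
next
  case (insert P F)
  let ?f = "\<lambda>Q :: 'a poly. x ^ omega_poly Q * s ^ degree Q"
  let ?F = "\<Prod>P\<in>F. 1 + x * s ^ degree P / (1 - s ^ degree P)"
  define u where "u = s ^ degree P"
  define c where "c k = (if k = 0 then 1 else x * u ^ k)" for k :: nat
  have P: "P \<in> monic_irreducibles" "P \<notin> F" using insert by auto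
  have u: "0 \<le> u" "u < 1"
    using s monic_irreducibleD(5)[OF P(1)] by (auto simp: u_def power_less_one_iff)
  have c0: "c k \<ge> 0" for k using x u by (auto simp: c_def)
  have f: "?f (P ^ k * Q) = c k * ?f Q" if Q: "Q \<in> monics_over F" for k Q
  proof -
    have Q0: "Q \<noteq> 0" using Q by (auto simp: monics_over_def)
    have "P \<notin> monic_prime_divisors Q" using Q P by (auto simp: monics_over_def)
    then have "omega_poly (P ^ k * Q) = (if k = 0 then 0 else 1) + omega_poly Q"
      using finite_monic_prime_divisors[OF Q0]
      by (simp add: omega_poly_eq monic_prime_divisors_power_mult[OF P(1)])
    moreover have "degree (P ^ k * Q) = degree P * k + degree Q"
      using Q0 monic_irreducibleD(4)[OF P(1)] by (simp add: degree_mult_eq degree_power_eq mult.commute)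
    ultimately show ?thesis by (simp add: c_def u_def power_add power_mult)
  qed
  have inner: "((\<lambda>Q. (\<lambda>(k, Q). c k * ?f Q) (k, Q)) has_sum c k * ?F) (monics_over F)" for k
    using insert has_sum_cmult_right[of ?f "monics_over F" ?F "c k"] by simp
  have outer: "((\<lambda>k. c k * ?F) has_sum (1 + x * u / (1 - u)) * ?F) UNIV"
    unfolding c_def by (intro has_sum_cmult_left has_sum_euler_factor x u)
  have "((\<lambda>(k, Q). c k * ?f Q) has_sum (1 + x * u / (1 - u)) * ?F) (UNIV \<times> monics_over F)"
  proof (rule has_sum_SigmaI[OF inner outer])
    show "(\<lambda>(k, Q). c k * ?f Q) summable_on UNIV \<times> monics_over F"
      by (rule summable_on_SigmaI[OF inner has_sum_imp_summable[OF outer]]) (use c0 x s in auto)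
  qed
  then have "((\<lambda>kQ. ?f ((\<lambda>(k, Q). P ^ k * Q) kQ)) has_sum (1 + x * u / (1 - u)) * ?F)
      (UNIV \<times> monics_over F)"
    by (rule has_sum_cong[THEN iffD1, rotated]) (auto simp: f)
  then have "(?f has_sum (1 + x * u / (1 - u)) * ?F) (monics_over (insert P F))"
    by (subst (asm) has_sum_reindex_bij_betw[OF bij_betw_monics_over_insert[OF P]])
  then show ?case using insert by (simp add: u_def)
qed

lemma card_monic_polys: "card (monic_polys n :: 'a :: {field, finite} poly set) = CARD('a) ^ n"
proof (rule order_antisym[OF card_monic_polys_le])
  let ?L = "{xs :: 'a list. set xs \<subseteq> UNIV \<and> length xs = n}"
  have coeff: "coeff (Poly (xs @ [1])) i = (if i < n then xs ! i else if i = n then 1 else 0)"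
    if "xs \<in> ?L" for xs :: "'a list" and i
    using that by (auto simp: nth_default_def nth_append)
  have "inj_on (\<lambda>xs. Poly (xs @ [1])) ?L"
  proof (rule inj_onI)
    fix xs ys assume L: "xs \<in> ?L" "ys \<in> ?L" and eq: "Poly (xs @ [1]) = Poly (ys @ [1])"
    show "xs = ys"
    proof (rule nth_equalityI)
      fix i assume "i < length xs"
      then show "xs ! i = ys ! i"
        using coeff[OF L(1), of i] coeff[OF L(2), of i] L eq by simp
    qed (use L in auto)
  qed
  moreover have "Poly (xs @ [1]) \<in> monic_polys n" if "xs \<in> ?L" for xs
  proof -
    have "degree (Poly (xs @ [1])) = n"
      using coeff[OF that] by (intro order_antisym degree_le le_degree) auto
    then show ?thesis using coeff[OF that, of n] by (simp only: monic_polys_def) simp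
  qed
  ultimately have "card ?L \<le> card (monic_polys n :: 'a poly set)"
    by (intro card_inj_on_le[where f = "\<lambda>xs. Poly (xs @ [1])"] finite_monic_polys) auto
  then show "CARD('a) ^ n \<le> card (monic_polys n :: 'a poly set)"
    using card_lists_length_eq[of "UNIV :: 'a set" n] by simp
qed

lemma monic_polys_nonempty: "(monic_polys n :: 'a :: {field, finite} poly set) \<noteq> {}"
  using card_monic_polys[of n, where 'a = 'a] by auto

lemma uniform_monic_expectation:
  "(\<integral>Q. z ^ omega_poly Q \<partial>(uniform_monic n :: 'a :: {field, finite} poly measure)) =
     (\<Sum>Q\<in>(monic_polys n :: 'a poly set). z ^ omega_poly Q) / of_nat (CARD('a) ^ n)"
  for z :: complex
  unfolding uniform_monic_def
  by (subst integral_measure_pmf[OF finite_monic_polys[of n]])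
    (auto simp: monic_polys_nonempty finite_monic_polys card_monic_polys sum_divide_distrib
      scaleR_conv_of_real)

text \<open>
  The expectation of \<open>x ^ omega_poly Q\<close> for \<open>Q\<close> uniform among the monic polynomials of degree
  \<open>n\<close>, for real \<open>x\<close>; the complex version is \<open>uniform_monic_expectation\<close>.
\<close>

definition mean_power_omega :: "'a :: {field, finite} itself \<Rightarrow> real \<Rightarrow> nat \<Rightarrow> real" where
  "mean_power_omega _ x n = (\<Sum>Q\<in>(monic_polys n :: 'a poly set). x ^ omega_poly Q) / real (CARD('a) ^ n)"

lemma mean_power_omega_bounds:
  assumes "0 \<le> x" "x \<le> 1"
  shows "0 \<le> mean_power_omega TYPE('a :: {field, finite}) x n" "mean_power_omega TYPE('a) x n \<le> 1"
proof -
  show "0 \<le> mean_power_omega TYPE('a) x n"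
    using assms by (auto simp: mean_power_omega_def intro!: divide_nonneg_nonneg sum_nonneg)
  have "(\<Sum>Q\<in>(monic_polys n :: 'a poly set). x ^ omega_poly Q) \<le> (\<Sum>Q\<in>(monic_polys n :: 'a poly set). 1)"
    using assms by (intro sum_mono power_le_one)
  also have "\<dots> = real (CARD('a) ^ n)" by (simp add: card_monic_polys)
  finally show "mean_power_omega TYPE('a) x n \<le> 1"
    using CARD_field_ge_2[where 'a = 'a] by (simp add: mean_power_omega_def divide_le_eq_1)
qed

lemma summable_mean_power_omega:
  assumes "0 \<le> x" "x \<le> 1" "0 \<le> t" "t < 1"
  shows "summable (\<lambda>n. mean_power_omega TYPE('a :: {field, finite}) x n * t ^ n)"
proof (rule summable_comparison_test[OF _ summable_geometric])
  show "\<exists>N. \<forall>n\<ge>N. norm (mean_power_omega TYPE('a) x n * t ^ n) \<le> t ^ n"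
    using mean_power_omega_bounds[OF assms(1,2), where 'a = 'a] assms
    by (auto simp: abs_mult intro!: mult_left_le_one_le)
qed (use assms in auto)

lemma mean_power_omega_1: "mean_power_omega TYPE('a :: {field, finite}) 1 n = 1"
  using CARD_field_ge_2[where 'a = 'a] by (simp add: mean_power_omega_def card_monic_polys)

text \<open>
  The finite product over the primes of degree at most \<open>N\<close> is the sum of the weights over the
  monic polynomials built from these primes. All monic polynomials of degree below \<open>N\<close> are among
  them, and all weights are nonnegative, so the product lies between a partial sum of the power
  series and its total. The variable \<open>t = q * s\<close> normalises the disc of convergence to radius 1.
\<close>

lemma euler_product:
  fixes x t :: real
  assumes x: "0 \<le> x" "x \<le> 1" and t: "0 \<le> t" "t < 1"
  shows "(\<lambda>N. \<Prod>P\<in>(irreducibles_upto N :: 'a :: {field, finite} poly set).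
            1 + x * (t / CARD('a)) ^ degree P / (1 - (t / CARD('a)) ^ degree P))
         \<longlonglongrightarrow> (\<Sum>n. mean_power_omega TYPE('a) x n * t ^ n)"
    (is "(\<lambda>N. ?p N) \<longlonglongrightarrow> ?A")
proof -
  define s where "s = t / CARD('a)"
  have q: "real CARD('a) \<ge> 2" using CARD_field_ge_2[where 'a = 'a] by simp
  have s: "0 \<le> s" "s < 1" using t q by (auto simp: s_def divide_less_eq)
  let ?f = "\<lambda>Q :: 'a poly. x ^ omega_poly Q * s ^ degree Q"
  have f0: "?f Q \<ge> 0" for Q using x s by simp
  have p: "(?f has_sum ?p N) (monics_over (irreducibles_upto N))" for N
    unfolding s_def[symmetric]
    by (rule has_sum_monics_over) (use x s finite_irreducibles_upto irreducibles_upto_subset in auto)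
  note sm = summable_mean_power_omega[OF x t, where 'a = 'a]
  have layer: "(\<Sum>Q\<in>monic_polys n. ?f Q) = mean_power_omega TYPE('a) x n * t ^ n" for n
  proof -
    have "(\<Sum>Q\<in>monic_polys n. ?f Q) = (\<Sum>Q\<in>(monic_polys n :: 'a poly set). x ^ omega_poly Q * s ^ n)"
      by (intro sum.cong) (auto simp: monic_polys_def)
    then show ?thesis
      by (simp add: mean_power_omega_def s_def power_divide sum_distrib_right sum_divide_distrib)
  qed
  have part: "(\<Sum>Q\<in>(\<Union>n<N. monic_polys n). ?f Q) = (\<Sum>n<N. mean_power_omega TYPE('a) x n * t ^ n)" for N
    unfolding layer[symmetric] using finite_monic_polys[where 'a = 'a]
    by (intro sum.UNION_disjoint) (auto simp: monic_polys_def)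
  have upper: "?p N \<le> ?A" for N
  proof (rule has_sum_le_finite_sums[OF p])
    fix F assume F: "finite F" "F \<subseteq> monics_over (irreducibles_upto N :: 'a poly set)"
    define M where "M = Suc (Max (degree ` F))"
    have "F \<subseteq> (\<Union>n<M. monic_polys n)"
    proof
      fix Q assume "Q \<in> F"
      then have "degree Q < M" "lead_coeff Q = 1" using F by (auto simp: M_def less_Suc_eq_le monics_over_def)
      then show "Q \<in> (\<Union>n<M. monic_polys n)" by (auto simp: monic_polys_def)
    qed
    then have "sum ?f F \<le> (\<Sum>Q\<in>(\<Union>n<M. monic_polys n). ?f Q)"
      using f0 finite_monic_polys[where 'a = 'a] by (intro sum_mono2) auto
    also have "\<dots> \<le> ?A" unfolding part
      using mean_power_omega_bounds[OF x, where 'a = 'a] t by (intro sum_le_suminf sm) auto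
    finally show "sum ?f F \<le> ?A" .
  qed
  have lower: "(\<Sum>n<N. mean_power_omega TYPE('a) x n * t ^ n) \<le> ?p N" for N
    unfolding part[symmetric]
  proof (rule finite_sum_le_has_sum[OF p])
    show "(\<Union>n<N. monic_polys n) \<subseteq> monics_over (irreducibles_upto N :: 'a poly set)"
    proof
      fix Q :: "'a poly" assume "Q \<in> (\<Union>n<N. monic_polys n)"
      then have Q: "lead_coeff Q = 1" "degree Q \<le> N" by (auto simp: monic_polys_def)
      then have "Q \<noteq> 0" by auto
      then have "monic_prime_divisors Q \<subseteq> irreducibles_upto N"
        using Q(2) by (auto simp: monic_prime_divisors_def irreducibles_upto_def dest: dvd_imp_degree_le)
      then show "Q \<in> monics_over (irreducibles_upto N)" using Q by (simp add: monics_over_def)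
    qed
  qed (use f0 finite_monic_polys in auto)
  show ?thesis
    by (rule tendsto_sandwich[OF _ _ summable_LIMSEQ[OF sm] tendsto_const])
      (use upper lower in auto)
qed

section \<open>An Abelian theorem\<close>

text \<open>
  Replacing \<open>a n\<close> by \<open>L * b n\<close> costs at most \<open>d * b n\<close> for large \<open>n\<close>, and a bounded amount for the
  finitely many remaining \<open>n\<close>; the latter is negligible because the comparison series diverges at 1.
\<close>

lemma abel_comparison:
  fixes a b :: "nat \<Rightarrow> real"
  assumes b: "\<And>n. b n > 0" and lim: "(\<lambda>n. a n / b n) \<longlonglongrightarrow> L"
    and sa: "\<And>t. 0 < t \<Longrightarrow> t < 1 \<Longrightarrow> summable (\<lambda>n. a n * t ^ n)"
    and sb: "\<And>t. 0 < t \<Longrightarrow> t < 1 \<Longrightarrow> summable (\<lambda>n. b n * t ^ n)"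
    and B: "filterlim (\<lambda>t. \<Sum>n. b n * t ^ n) at_top (at_left 1)"
  shows "((\<lambda>t. (\<Sum>n. a n * t ^ n) / (\<Sum>n. b n * t ^ n)) \<longlongrightarrow> L) (at_left 1)"
proof (rule tendstoI)
  fix e :: real assume e: "e > 0"
  define d where "d = e / 2"
  have d: "d > 0" using e by (simp add: d_def)
  obtain N where N: "\<And>n. n \<ge> N \<Longrightarrow> \<bar>a n / b n - L\<bar> < d"
    using LIMSEQ_D[OF lim d] by auto
  define c where "c n = (if n < N then \<bar>a n - L * b n\<bar> else 0)" for n
  define K where "K = (\<Sum>n<N. \<bar>a n - L * b n\<bar>)"
  have bound: "\<bar>a n - L * b n\<bar> \<le> d * b n + c n" for n
  proof (cases "n < N")
    case False
    then have "\<bar>a n / b n - L\<bar> * b n \<le> d * b n" using N[of n] b[of n] by (intro mult_right_mono) auto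
    moreover have "\<bar>a n / b n - L\<bar> * b n = \<bar>a n - L * b n\<bar>"
      using b[of n] by (simp add: abs_mult_pos left_diff_distrib)
    ultimately show ?thesis using False by (simp add: c_def)
  qed (use b[of n] d in \<open>simp add: c_def less_imp_le\<close>)
  have close: "\<bar>(\<Sum>n. a n * t ^ n) - L * (\<Sum>n. b n * t ^ n)\<bar> \<le> d * (\<Sum>n. b n * t ^ n) + K"
    if t: "0 < t" "t < 1" for t
  proof -
    have c: "(\<lambda>n. c n * t ^ n) sums (\<Sum>n<N. c n * t ^ n)"
      by (rule sums_finite) (auto simp: c_def)
    have "(\<Sum>n<N. c n * t ^ n) \<le> (\<Sum>n<N. c n)"
      using t by (intro sum_mono mult_left_le power_le_one) (auto simp: c_def)
    then have cK: "(\<Sum>n. c n * t ^ n) \<le> K"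
      using c by (simp add: c_def K_def sums_iff)
    have s1: "summable (\<lambda>n. (a n - L * b n) * t ^ n)"
      using summable_diff[OF sa[OF t] summable_mult[OF sb[OF t], of L]]
      by (simp add: left_diff_distrib mult.assoc)
    have s2: "(\<lambda>n. (d * b n + c n) * t ^ n) sums (d * (\<Sum>n. b n * t ^ n) + (\<Sum>n. c n * t ^ n))"
      using sums_add[OF sums_mult[OF summable_sums[OF sb[OF t]], of d] summable_sums[OF sums_summable[OF c]]]
      by (simp add: distrib_right mult.assoc)
    have n: "norm ((a n - L * b n) * t ^ n) \<le> (d * b n + c n) * t ^ n" for n
      using t bound[of n] by (auto simp: abs_mult intro: mult_right_mono)
    have "norm (\<Sum>n. (a n - L * b n) * t ^ n) \<le> (\<Sum>n. (d * b n + c n) * t ^ n)"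
      by (rule norm_suminf_le[OF n sums_summable[OF s2]])
    moreover have "(\<Sum>n. (a n - L * b n) * t ^ n) = (\<Sum>n. a n * t ^ n) - L * (\<Sum>n. b n * t ^ n)"
      using suminf_diff[OF sa[OF t] summable_mult[OF sb[OF t], of L]] suminf_mult[OF sb[OF t], of L]
      by (simp add: left_diff_distrib mult.assoc)
    ultimately show ?thesis using s2 cK by (simp add: sums_iff)
  qed
  have "\<forall>\<^sub>F t in at_left 1. (\<Sum>n. b n * t ^ n) > max 0 (K / d)"
    using B unfolding filterlim_at_top_dense by blast
  moreover have "\<forall>\<^sub>F t in at_left (1::real). t \<in> {0<..<1}"
    by (rule eventually_at_left_real) simp
  ultimately show "\<forall>\<^sub>F t in at_left 1. dist ((\<Sum>n. a n * t ^ n) / (\<Sum>n. b n * t ^ n)) L < e"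
  proof eventually_elim
    case (elim t)
    let ?A = "\<Sum>n. a n * t ^ n" and ?B = "\<Sum>n. b n * t ^ n"
    have B0: "?B > 0" and "K < d * ?B" using elim d by (auto simp: field_simps)
    then have "\<bar>?A - L * ?B\<bar> < e * ?B" using close[of t] elim by (simp add: d_def)
    moreover have "\<bar>?A / ?B - L\<bar> * ?B = \<bar>?A - L * ?B\<bar>"
      using B0 by (simp add: abs_mult_pos left_diff_distrib)
    ultimately have "\<bar>?A / ?B - L\<bar> * ?B < e * ?B" by simp
    then show ?case using B0 by (simp only: dist_real_def mult_less_cancel_right_pos)
  qed
qed

lemma binomial_series_neg_power:
  fixes x t :: real
  assumes "0 < t" "t < 1"
  shows "(\<lambda>n. pochhammer x n / fact n * t ^ n) sums (1 - t) powr (- x)"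
proof -
  have "((- x) gchoose n) * (- t) ^ n = pochhammer x n / fact n * t ^ n" for n
  proof -
    have "(- t) ^ n = (- 1) ^ n * t ^ n" by (rule power_minus)
    moreover have "(- 1) ^ n * (- 1) ^ n = (1 :: real)" by (simp flip: power_mult_distrib)
    ultimately show ?thesis by (simp add: gbinomial_pochhammer)
  qed
  then show ?thesis using gen_binomial_real[of "- t" "- x"] assms by simp
qed

text \<open>
  An Abelian counterpart of singularity analysis: coefficients asymptotic to \<open>c * n powr (x - 1)\<close>
  force the generating function to behave like \<open>c * Gamma x * (1 - t) powr (- x)\<close> at 1. The
  comparison series is the binomial series of \<open>(1 - t) powr (- x)\<close>, and Gauss's limit formula for
  the Gamma function gives the asymptotics \<open>n powr (x - 1) / Gamma x\<close> of its coefficients. This is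
  where the factor \<open>Gamma\<close> of the final formula comes from.
\<close>

lemma abel_power_singularity:
  fixes a :: "nat \<Rightarrow> real"
  assumes x: "x > 0" and lim: "(\<lambda>n. a n / real n powr (x - 1)) \<longlonglongrightarrow> c"
    and sa: "\<And>t. 0 < t \<Longrightarrow> t < 1 \<Longrightarrow> summable (\<lambda>n. a n * t ^ n)"
  shows "((\<lambda>t. (\<Sum>n. a n * t ^ n) * (1 - t) powr x) \<longlongrightarrow> c * Gamma x) (at_left 1)"
proof -
  define b where "b n = pochhammer x n / fact n" for n
  have b: "b n > 0" for n using x by (simp add: b_def pochhammer_pos)
  have sums: "(\<lambda>n. b n * t ^ n) sums (1 - t) powr (- x)" if "0 < t" "t < 1" for t
    unfolding b_def using binomial_series_neg_power[OF that] .
  have ev: "\<forall>\<^sub>F t in at_left (1::real). t \<in> {0<..<1}" by (rule eventually_at_left_real) simp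
  have "filterlim (\<lambda>t::real. (1 - t) powr (- x)) at_top (at_left 1)"
    using x by real_asymp
  then have B: "filterlim (\<lambda>t. \<Sum>n. b n * t ^ n) at_top (at_left 1)"
  proof (rule filterlim_mono_eventually[OF _ order_refl order_refl])
    show "\<forall>\<^sub>F t in at_left 1. (1 - t) powr (- x) = (\<Sum>n. b n * t ^ n)"
      using ev by eventually_elim (use sums in \<open>simp add: sums_iff\<close>)
  qed
  have "(\<lambda>n. a n / b n) \<longlonglongrightarrow> c * Gamma x"
  proof -
    \<comment> \<open>The series for \<open>rGamma\<close> contains \<open>pochhammer x (n + 1)\<close>, which has the factor \<open>x + n\<close> in excess.\<close>
    have "(\<lambda>n. real n / (x + real n)) \<longlonglongrightarrow> 1" by real_asymp
    then have "(\<lambda>n. a n / real n powr (x - 1) * inverse (rGamma_series x n * (real n / (x + real n))))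
        \<longlonglongrightarrow> c * inverse (rGamma x * 1)"
      by (intro tendsto_intros lim rGamma_series_LIMSEQ) (use x in \<open>auto simp: rGamma_eq_zero_iff dest: nonpos_Ints_nonpos\<close>)
    then have "(\<lambda>n. a n / real n powr (x - 1) * inverse (rGamma_series x n * (real n / (x + real n))))
        \<longlonglongrightarrow> c * Gamma x" by (simp add: Gamma_def)
    moreover have "\<forall>\<^sub>F n in sequentially.
        a n / real n powr (x - 1) * inverse (rGamma_series x n * (real n / (x + real n))) = a n / b n"
      using eventually_gt_at_top[of 0]
    proof eventually_elim
      case (elim n)
      have "exp (x * ln (real n)) = real n powr x" using elim by (simp add: powr_def)
      then have "rGamma_series x n = b n * (x + real n) / real n powr x"
        by (simp add: rGamma_series_def b_def pochhammer_rec' mult.commute)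
      then have "rGamma_series x n * (real n / (x + real n)) * real n powr (x - 1) = b n"
        using elim x by (simp add: powr_diff)
      moreover have "a n / p * inverse w = a n / (w * p)" for p w
        by (simp add: divide_inverse mult_ac)
      ultimately show ?case by (simp only:)
    qed
    ultimately show ?thesis by (rule Lim_transform_eventually)
  qed
  from abel_comparison[OF b this sa sums_summable[OF sums] B]
  have "((\<lambda>t. (\<Sum>n. a n * t ^ n) / (\<Sum>n. b n * t ^ n)) \<longlongrightarrow> c * Gamma x) (at_left 1)" by blast
  moreover have "\<forall>\<^sub>F t in at_left 1.
      (\<Sum>n. a n * t ^ n) / (\<Sum>n. b n * t ^ n) = (\<Sum>n. a n * t ^ n) * (1 - t) powr x"
    using ev by eventually_elim (use sums in \<open>simp add: sums_iff powr_minus divide_inverse\<close>)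
  ultimately show ?thesis by (rule Lim_transform_eventually)
qed

section \<open>The regularised Euler product\<close>

text \<open>
  With \<open>u = (t / q) ^ degree P\<close>, the local factor \<open>1 + x * u / (1 - u)\<close> multiplied by \<open>(1 - u) powr x\<close>,
  that is, divided by the \<open>x\<close>-th power of the local factor \<open>1 / (1 - u)\<close> of the zeta function of
  \<open>F_q[X]\<close>.
\<close>

definition regular_factor :: "real \<Rightarrow> real \<Rightarrow> real" where
  "regular_factor x u = (1 - (1 - x) * u) * (1 - u) powr (x - 1)"

text \<open>
  The terms of first order in \<open>u\<close> cancel, which makes the product over all primes converge up
  to \<open>t = 1\<close>, where \<open>u = 1 / |P|\<close>. With \<open>y = 1 - x\<close>, the factor is \<open>(1 - y * u) / (1 - u) powr y\<close>, and
  weighted arithmetic-geometric means with weights \<open>y\<close> and \<open>1 - y\<close>, applied to \<open>1 - u\<close> and 1 and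
  to \<open>1 / (1 - u)\<close> and 1, bound it from below and from above.
\<close>

lemma regular_factor_bounds:
  fixes x u :: real
  assumes x: "0 \<le> x" "x \<le> 1" and u: "0 \<le> u" "u \<le> 1 / 2"
  shows "\<bar>regular_factor x u - 1\<bar> \<le> 2 * u\<^sup>2"
proof -
  define y where "y = 1 - x"
  have y: "0 \<le> y" "y \<le> 1" using x by (auto simp: y_def)
  have yu: "y * u \<le> 1 / 2" using y u mult_left_le_one_le[of u y] by linarith
  have g: "regular_factor x u = (1 - y * u) * (1 - u) powr (- y)"
    by (simp add: regular_factor_def y_def)
  have "(1 - u) powr y * 1 powr (1 - y) \<le> y * (1 - u) + (1 - y) * 1"
    using y u by (intro Youngs_inequality_0) auto
  then have low: "(1 - u) powr y \<le> 1 - y * u" by (simp add: algebra_simps)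
  have "(1 / (1 - u)) powr y * 1 powr (1 - y) \<le> y * (1 / (1 - u)) + (1 - y) * 1"
    using y u by (intro Youngs_inequality_0) auto
  moreover have "(1 / (1 - u)) powr y = (1 - u) powr (- y)"
    using u by (simp add: powr_divide powr_minus_divide)
  ultimately have high: "(1 - u) powr (- y) \<le> y / (1 - u) + 1 - y" by simp
  have "1 \<le> regular_factor x u"
  proof -
    have "(1 - u) powr y * (1 - u) powr (- y) = 1" using u by (simp flip: powr_add)
    then show ?thesis using mult_right_mono[OF low, of "(1 - u) powr (- y)"] by (simp add: g)
  qed
  moreover have "regular_factor x u \<le> 1 + 2 * u\<^sup>2"
  proof -
    have "regular_factor x u \<le> (1 - y * u) * (y / (1 - u) + 1 - y)"
      unfolding g using yu by (intro mult_left_mono high) auto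
    also have "\<dots> = 1 + y * (1 - y) * u\<^sup>2 / (1 - u)"
      using u by (simp add: field_simps power2_eq_square)
    also have "y * (1 - y) * u\<^sup>2 / (1 - u) \<le> u\<^sup>2 / (1 / 2)"
      using y u mult_le_one[of y "1 - y"] by (intro frac_le mult_left_le_one_le) auto
    finally show ?thesis by simp
  qed
  ultimately show ?thesis by simp
qed

definition regular_product :: "'a :: {field, finite} itself \<Rightarrow> real \<Rightarrow> nat \<Rightarrow> real \<Rightarrow> real" where
  "regular_product _ x N t =
     (\<Prod>P\<in>(irreducibles_upto N :: 'a poly set). regular_factor x ((t / real CARD('a)) ^ degree P))"

lemma local_variable_bounds:
  fixes P :: "'a :: {field, finite} poly"
  assumes "P \<in> monic_irreducibles" "0 \<le> t" "t \<le> 1"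
  shows "0 \<le> (t / real CARD('a)) ^ degree P"
    "(t / real CARD('a)) ^ degree P \<le> 1 / real (poly_abs P)"
    "1 / real (poly_abs P) \<le> 1 / 2"
proof -
  have q: "real CARD('a) \<ge> 2" using CARD_field_ge_2[where 'a = 'a] by simp
  show "0 \<le> (t / real CARD('a)) ^ degree P" using assms by simp
  have "(t / real CARD('a)) ^ degree P \<le> (1 / real CARD('a)) ^ degree P"
    using assms q by (intro power_mono divide_right_mono) auto
  then show "(t / real CARD('a)) ^ degree P \<le> 1 / real (poly_abs P)"
    by (simp add: poly_abs_def power_divide)
  have "(1 / real CARD('a)) ^ degree P \<le> (1 / real CARD('a)) ^ 1"
    using monic_irreducibleD(5)[OF assms(1)] q by (intro power_decreasing) auto
  also have "\<dots> \<le> 1 / 2" using q by (simp add: divide_simps)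
  finally show "1 / real (poly_abs P) \<le> 1 / 2" by (simp add: poly_abs_def power_divide)
qed

text \<open>
  By \<open>regular_factor_bounds\<close>, the factor at \<open>P\<close> differs from 1 by at most \<open>2 / |P|\<^sup>2\<close>, uniformly in
  \<open>t\<close> up to the edge \<open>t = 1\<close>, and these bounds are summable. The criterion for infinite products
  is about complex functions, so the interval is embedded into the complex plane and the real
  part of the limit is taken.
\<close>

lemma uniform_limit_regular_product:
  assumes x: "0 \<le> x" "x \<le> 1"
  shows "\<exists>G. uniform_limit {0..1} (regular_product TYPE('a :: {field, finite}) x) G sequentially"
proof -
  define S where "S = complex_of_real ` {0..1}"
  define f where "f P z = complex_of_real (regular_factor x ((Re z / real CARD('a)) ^ degree P))"
    for P :: "'a poly" and z
  have bound: "norm (f P z - 1) \<le> 2 * (1 / real (poly_abs P) ^ 2)"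
    if "P \<in> monic_irreducibles" "z \<in> S" for P z
  proof -
    define u where "u = (Re z / real CARD('a)) ^ degree P"
    have z: "0 \<le> Re z" "Re z \<le> 1" using that by (auto simp: S_def)
    note u = local_variable_bounds[OF that(1) z, folded u_def]
    have "f P z - 1 = of_real (regular_factor x u - 1)" by (simp add: f_def u_def)
    then have "norm (f P z - 1) = \<bar>regular_factor x u - 1\<bar>" by (simp only: norm_of_real)
    also have "\<dots> \<le> 2 * u\<^sup>2" using u by (intro regular_factor_bounds x) auto
    also have "\<dots> \<le> 2 * (1 / real (poly_abs P))\<^sup>2"
      using u by (intro mult_left_mono power_mono) auto
    finally show ?thesis by (simp add: power_divide)
  qed
  have "(\<lambda>P :: 'a poly. 2 * (1 / real (poly_abs P) ^ 2)) summable_on monic_irreducibles"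
    by (intro summable_on_cmult_right summable_poly_abs)
  then have "\<exists>g. uniform_limit S (\<lambda>n z. \<Prod>P\<in>irreducibles_upto n. f P z) g sequentially \<and>
      (\<forall>z\<in>S. ((\<lambda>F. \<Prod>P\<in>F. f P z) \<longlongrightarrow> g z) (finite_subsets_at_top monic_irreducibles))"
    by (rule uniform_limit_prod_along_finite_sets)
      (rule bound finite_irreducibles_upto incseq_irreducibles_upto UN_irreducibles_upto | assumption)+
  then obtain g where g: "uniform_limit S (\<lambda>n z. \<Prod>P\<in>irreducibles_upto n. f P z) g sequentially"
    by blast
  have f: "(\<Prod>P\<in>irreducibles_upto n. f P (of_real t)) = of_real (regular_product TYPE('a) x n t)" for n t
    by (simp add: regular_product_def f_def)
  have "uniform_limit {0..1} (regular_product TYPE('a) x) (\<lambda>t. Re (g (of_real t))) sequentially"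
  proof (rule uniform_limitI)
    fix e :: real assume "e > 0"
    have le: "\<bar>r - Re w\<bar> \<le> norm (of_real r - w)" for r w
      using abs_Re_le_cmod[of "of_real r - w"] by simp
    show "\<forall>\<^sub>F n in sequentially. \<forall>t\<in>{0..1}.
        dist (regular_product TYPE('a) x n t) (Re (g (of_real t))) < e"
      using uniform_limitD[OF g \<open>e > 0\<close>]
    proof eventually_elim
      case (elim n)
      show ?case
      proof
        fix t :: real assume "t \<in> {0..1}"
        then have "dist (of_real (regular_product TYPE('a) x n t)) (g (of_real t)) < e"
          using elim[rule_format, of "of_real t"] unfolding f by (simp add: S_def)
        then show "dist (regular_product TYPE('a) x n t) (Re (g (of_real t))) < e"
          using le[of "regular_product TYPE('a) x n t" "g (of_real t)"] unfolding dist_norm real_norm_def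
          by linarith
      qed
    qed
  qed
  then show ?thesis by blast
qed

lemma continuous_on_regular_product:
  "continuous_on {0..1} (regular_product TYPE('a :: {field, finite}) x N)"
proof -
  have "continuous_on {0..1} (\<lambda>t. regular_factor x ((t / real CARD('a)) ^ degree P))"
    if P: "P \<in> monic_irreducibles" for P :: "'a poly"
    unfolding regular_factor_def
  proof (intro continuous_intros ballI)
    fix t :: real assume "t \<in> {0..1}"
    then show "1 - (t / real CARD('a)) ^ degree P \<noteq> 0"
      using local_variable_bounds(2,3)[OF P, of t] by simp
  qed (use CARD_field_ge_2[where 'a = 'a] in auto)
  then show ?thesis
    unfolding regular_product_def[abs_def] using irreducibles_upto_subset
    by (intro continuous_on_prod) blast
qed

text \<open>
  Inside the disc the Euler product may be split: the case \<open>x = 1\<close> is the zeta function, whose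
  power series is geometric with sum \<open>1 / (1 - t)\<close>.
\<close>

lemma regular_product_tendsto:
  assumes x: "0 \<le> x" "x \<le> 1" and t: "0 < t" "t < 1"
  shows "(\<lambda>N. regular_product TYPE('a :: {field, finite}) x N t) \<longlonglongrightarrow>
           (\<Sum>n. mean_power_omega TYPE('a) x n * t ^ n) * (1 - t) powr x"
proof -
  let ?E = "\<lambda>x N. \<Prod>P\<in>(irreducibles_upto N :: 'a poly set).
      1 + x * (t / CARD('a)) ^ degree P / (1 - (t / CARD('a)) ^ degree P)"
  have "(\<Sum>n. mean_power_omega TYPE('a) 1 n * t ^ n) = 1 / (1 - t)"
    using t by (simp add: mean_power_omega_1 suminf_geometric)
  then have 1: "?E 1 \<longlonglongrightarrow> 1 / (1 - t)"
    using euler_product[of 1 t, where 'a = 'a] t by simp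
  have "(\<lambda>N. ?E x N * ?E 1 N powr (- x)) \<longlonglongrightarrow>
      (\<Sum>n. mean_power_omega TYPE('a) x n * t ^ n) * (1 / (1 - t)) powr (- x)"
    by (rule tendsto_mult[OF euler_product[OF x less_imp_le[OF t(1)] t(2)]
          tendsto_powr[OF 1 tendsto_const]]) (use t in auto)
  moreover have "(1 / (1 - t)) powr (- x) = (1 - t) powr x"
    using t by (simp add: powr_divide powr_minus_divide)
  moreover have "?E x N * ?E 1 N powr (- x) = regular_product TYPE('a) x N t" for N
  proof -
    have u: "0 \<le> (t / real CARD('a)) ^ degree P" "(t / real CARD('a)) ^ degree P < 1"
      if "P \<in> irreducibles_upto N" for P :: "'a poly"
      using local_variable_bounds[of P t] that t by (auto simp: irreducibles_upto_def)
    have factor: "(1 + x * v / (1 - v)) * (1 + 1 * v / (1 - v)) powr (- x) = regular_factor x v"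
      if "0 \<le> v" "v < 1" for v
    proof -
      have "1 + 1 * v / (1 - v) = 1 / (1 - v)" using that by (simp add: field_simps)
      then have 1: "(1 + 1 * v / (1 - v)) powr (- x) = (1 - v) powr x"
        using that by (simp only:) (simp add: powr_divide powr_minus_divide)
      have 2: "1 + x * v / (1 - v) = (1 - (1 - x) * v) / (1 - v)"
        using that by (simp add: field_simps)
      show ?thesis
        unfolding 1 2 using that by (simp add: regular_factor_def powr_diff)
    qed
    have "?E 1 N powr (- x) = (\<Prod>P\<in>(irreducibles_upto N :: 'a poly set).
      (1 + 1 * (t / CARD('a)) ^ degree P / (1 - (t / CARD('a)) ^ degree P)) powr (- x))"
      by (rule prod_powr_distrib)
    then show ?thesis
      unfolding regular_product_def using factor u
      by (simp only: prod.distrib[symmetric]) (intro prod.cong, auto)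
  qed
  ultimately show ?thesis by simp
qed

text \<open>
  The limits \<open>N \<rightarrow> \<infinity>\<close> and \<open>t \<rightarrow> 1\<close> may be interchanged, because the convergence in \<open>N\<close> is uniform
  up to and including \<open>t = 1\<close>.
\<close>

lemma regular_product_at_1_eq_limit:
  fixes L :: real
  assumes x: "0 \<le> x" "x \<le> 1"
    and L: "((\<lambda>t. (\<Sum>n. mean_power_omega TYPE('a :: {field, finite}) x n * t ^ n) * (1 - t) powr x) \<longlongrightarrow> L)
              (at_left 1)"
  shows "(\<lambda>N. regular_product TYPE('a) x N 1) \<longlonglongrightarrow> L"
proof -
  obtain G where G: "uniform_limit {0..1} (regular_product TYPE('a) x) G sequentially"
    using uniform_limit_regular_product[OF x] by blast
  have lim: "(\<lambda>N. regular_product TYPE('a) x N t) \<longlonglongrightarrow> G t" if "t \<in> {0..1}" for t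
    by (rule tendsto_uniform_limitI[OF G that])
  have "continuous_on {0..1} G"
    by (rule uniform_limit_theorem[OF always_eventually G])
      (simp_all add: continuous_on_regular_product)
  then have "(G \<longlongrightarrow> G 1) (at 1 within {0..1})" by (simp add: continuous_on_def)
  then have G1: "(G \<longlongrightarrow> G 1) (at_left 1)" by (simp add: at_within_Icc_at_left)
  have "\<forall>\<^sub>F t in at_left (1::real). t \<in> {0<..<1}" by (rule eventually_at_left_real) simp
  then have "\<forall>\<^sub>F t in at_left 1.
      G t = (\<Sum>n. mean_power_omega TYPE('a) x n * t ^ n) * (1 - t) powr x"
  proof eventually_elim
    case (elim t)
    then have t: "0 < t" "t < 1" by auto
    then show ?case
      using LIMSEQ_unique[OF lim regular_product_tendsto[OF x t]] by simp
  qed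
  from tendsto_unique[OF trivial_limit_at_left_real Lim_transform_eventually[OF G1 this] L]
  have "G 1 = L" .
  then show ?thesis using lim[of 1] by simp
qed

section \<open>The value of the regularised product at the edge of the disc\<close>

text \<open>
  The analogue for \<open>F_q[X]\<close> of \<open>M - \<gamma>\<close>, where \<open>M\<close> is the Meissel-Mertens constant of the primes and
  \<open>\<gamma>\<close> is Euler's constant.
\<close>

definition mertens_kappa :: "'a :: {field, finite} itself \<Rightarrow> real" where
  "mertens_kappa _ = (\<Sum>\<^sub>\<infinity>P\<in>(monic_irreducibles :: 'a poly set).
     ln (1 - 1 / real (poly_abs P)) + 1 / real (poly_abs P))"

lemma filterlim_finite_subsets_at_top_incseq:
  assumes "\<And>n. finite (D n)" "incseq D" "(\<Union>n. D n) = A"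
  shows "filterlim D (finite_subsets_at_top A) sequentially"
  unfolding filterlim_finite_subsets_at_top
proof (intro allI impI)
  fix X assume X: "finite X \<and> X \<subseteq> A"
  then have "finite X" "X \<subseteq> (\<Union>n. D n)" using assms(3) by auto
  then have "\<exists>N. X \<subseteq> D N"
  proof (induction X rule: finite_induct)
    case (insert x X)
    then obtain N n where "X \<subseteq> D N" "x \<in> D n" by auto
    moreover have "D N \<subseteq> D (max N n)" "D n \<subseteq> D (max N n)"
      by (rule incseqD[OF assms(2)]; simp)+
    ultimately show ?case by blast
  qed simp
  then obtain N where N: "X \<subseteq> D N" by blast
  then have "\<forall>n\<ge>N. X \<subseteq> D n" using assms(2) by (meson incseqD order_trans)
  then show "\<forall>\<^sub>F n in sequentially. finite (D n) \<and> X \<subseteq> D n \<and> D n \<subseteq> A"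
    using assms(1,3) unfolding eventually_sequentially by blast
qed

lemma sum_tendsto_mertens_kappa:
  "(\<lambda>N. \<Sum>P\<in>(irreducibles_upto N :: 'a :: {field, finite} poly set).
      ln (1 - 1 / real (poly_abs P)) + 1 / real (poly_abs P)) \<longlonglongrightarrow> mertens_kappa TYPE('a)"
proof -
  let ?h = "\<lambda>P :: 'a poly. ln (1 - 1 / real (poly_abs P)) + 1 / real (poly_abs P)"
  have "?h summable_on monic_irreducibles"
  proof (rule abs_summable_summable, rule Infinite_Sum.abs_summable_on_comparison_test')
    show "(\<lambda>P :: 'a poly. 2 * (1 / real (poly_abs P) ^ 2)) summable_on monic_irreducibles"
      by (intro summable_on_cmult_right summable_poly_abs)
    fix P :: "'a poly" assume "P \<in> monic_irreducibles"
    then have "\<bar>- (1 / real (poly_abs P))\<bar> \<le> 1 / 2"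
      using local_variable_bounds(3)[of P 1] by simp
    from abs_ln_one_plus_x_minus_x_bound[OF this]
    show "norm (?h P) \<le> 2 * (1 / real (poly_abs P) ^ 2)" by (simp add: power_divide)
  qed
  then have "(?h has_sum mertens_kappa TYPE('a)) monic_irreducibles"
    unfolding mertens_kappa_def by (rule has_sum_infsum)
  then have "(sum ?h \<longlongrightarrow> mertens_kappa TYPE('a)) (finite_subsets_at_top monic_irreducibles)"
    by (simp add: has_sum_def)
  moreover have "filterlim irreducibles_upto (finite_subsets_at_top (monic_irreducibles :: 'a poly set)) sequentially"
    by (rule filterlim_finite_subsets_at_top_incseq[OF finite_irreducibles_upto
          incseq_irreducibles_upto UN_irreducibles_upto])
  ultimately show ?thesis by (rule filterlim_compose)
qed

lemma mod_poisson_convergent_tendsto: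
  assumes "mod_poisson_convergent M X \<gamma> \<Phi>"
  shows "(\<lambda>n. poisson_ratio (M n) (X n) (\<gamma> n) z) \<longlonglongrightarrow> \<Phi> z"
proof -
  obtain r where "r > 0" and
    u: "uniform_limit (ball z r) (\<lambda>n. poisson_ratio (M n) (X n) (\<gamma> n)) \<Phi> sequentially"
    using assms unfolding mod_poisson_convergent_def by blast
  then show ?thesis by (intro tendsto_uniform_limitI[OF u]) simp
qed

text \<open>
  At \<open>t = 1\<close> the regularised factor is \<open>(1 + (x - 1) / |P|) * (1 - 1 / |P|) powr (x - 1)\<close>. It
  differs from the factor of the independent model only in having \<open>1 - 1 / |P|\<close> where the model
  has \<open>exp (- 1 / |P|)\<close>; the product of the quotients of these two, raised to the power \<open>x - 1\<close>,
  is \<open>exp (\<kappa> * (x - 1))\<close>.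
\<close>

lemma regular_product_at_1_tendsto_model:
  fixes B :: "'a :: {field, finite} poly \<Rightarrow> 'w \<Rightarrow> nat" and x :: real
  assumes B: "bernoulli_model M B"
  shows "(\<lambda>N. complex_of_real (regular_product TYPE('a) x N 1)) \<longlonglongrightarrow>
     exp (of_real (mertens_kappa TYPE('a)) * (of_real x - 1)) * Phi_model TYPE('a) (of_real x)"
proof -
  define \<gamma> where "\<gamma> n = (\<Sum>P\<in>(irreducibles_upto n :: 'a poly set). 1 / real (poly_abs P))" for n
  define \<kappa> where "\<kappa> n = (\<Sum>P\<in>(irreducibles_upto n :: 'a poly set).
      ln (1 - 1 / real (poly_abs P)) + 1 / real (poly_abs P))" for n
  have conv: "mod_poisson_convergent (\<lambda>_. M) (omega_model B) \<gamma> (Phi_model TYPE('a))"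
    using omega_model_mod_poisson[OF B] by (simp add: \<gamma>_def[abs_def] irreducibles_upto_def)
  then have pos: "\<forall>\<^sub>F n in sequentially. \<gamma> n > 0" by (simp add: mod_poisson_convergent_def)
  have "\<kappa> \<longlonglongrightarrow> mertens_kappa TYPE('a)"
    unfolding \<kappa>_def[abs_def] by (rule sum_tendsto_mertens_kappa)
  then have "(\<lambda>n. exp (of_real (\<kappa> n) * (of_real x - 1)) *
        poisson_ratio M (omega_model B n) (\<gamma> n) (of_real x)) \<longlonglongrightarrow>
      exp (of_real (mertens_kappa TYPE('a)) * (of_real x - 1)) * Phi_model TYPE('a) (of_real x)"
    by (intro tendsto_intros mod_poisson_convergent_tendsto[OF conv])
  moreover have "\<forall>\<^sub>F n in sequentially.
      exp (of_real (\<kappa> n) * (of_real x - 1)) * poisson_ratio M (omega_model B n) (\<gamma> n) (of_real x) =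
      complex_of_real (regular_product TYPE('a) x n 1)"
    using pos
  proof eventually_elim
    case (elim n)
    let ?I = "irreducibles_upto n :: 'a poly set"
    have fac: "regular_factor x ((1 / real CARD('a)) ^ degree P) =
        (1 + (x - 1) / real (poly_abs P)) * exp ((x - 1) * ln (1 - 1 / real (poly_abs P)))"
      if "P \<in> ?I" for P
    proof -
      have P: "P \<in> monic_irreducibles" using that irreducibles_upto_subset by blast
      have "(1 / real CARD('a)) ^ degree P = 1 / real (poly_abs P)"
        by (simp add: poly_abs_def power_divide)
      moreover have "1 - (1 - x) * (1 / real (poly_abs P)) = 1 + (x - 1) / real (poly_abs P)"
        by (simp add: algebra_simps diff_divide_distrib)
      moreover have "1 - 1 / real (poly_abs P) \<noteq> 0"
        using local_variable_bounds(3)[OF P, of 1] by linarith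
      ultimately show ?thesis by (simp only: regular_factor_def powr_def if_False)
    qed
    have "regular_product TYPE('a) x n 1 =
        (\<Prod>P\<in>?I. (1 + (x - 1) / real (poly_abs P)) * exp ((x - 1) * ln (1 - 1 / real (poly_abs P))))"
      unfolding regular_product_def by (rule prod.cong[OF refl fac])
    also have "\<dots> = (\<Prod>P\<in>?I. 1 + (x - 1) / real (poly_abs P)) *
        exp (\<Sum>P\<in>?I. (x - 1) * ln (1 - 1 / real (poly_abs P)))"
      by (simp only: prod.distrib exp_sum[OF finite_irreducibles_upto])
    also have "(\<Sum>P\<in>?I. (x - 1) * ln (1 - 1 / real (poly_abs P))) = \<kappa> n * (x - 1) - \<gamma> n * (x - 1)"
    proof -
      have "(\<Sum>P\<in>?I. ln (1 - 1 / real (poly_abs P))) = \<kappa> n - \<gamma> n"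
        by (simp only: \<kappa>_def \<gamma>_def sum.distrib)
      then show ?thesis
        by (simp only: sum_distrib_left[symmetric]) (simp add: algebra_simps)
    qed
    finally have reg: "regular_product TYPE('a) x n 1 =
        exp (\<kappa> n * (x - 1)) * ((\<Prod>P\<in>?I. 1 + (x - 1) / real (poly_abs P)) / exp (\<gamma> n * (x - 1)))"
      by (simp add: exp_diff)
    have "poisson_ratio M (omega_model B n) (\<gamma> n) (of_real x) =
        (\<Prod>P\<in>?I. 1 + (of_real x - 1) / of_nat (poly_abs P)) / exp (of_real (\<gamma> n) * (of_real x - 1))"
      by (simp add: poisson_ratio_def expectation_poisson_power[OF elim]
          bernoulli_model_expectation(1)[OF B] irreducibles_upto_def)
    moreover have "exp (complex_of_real r * (of_real x - 1)) = of_real (exp (r * (x - 1)))" for r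
      by (simp flip: exp_of_real)
    ultimately show ?case unfolding reg by simp
  qed
  ultimately show ?thesis by (rule Lim_transform_eventually)
qed

section \<open>Identification of the limiting function\<close>

text \<open>
  Mod-Poisson convergence at speed \<open>ln n\<close> gives the asymptotics \<open>\<Phi> x * n powr (x - 1)\<close> of the
  coefficients, since \<open>exp (ln n * (x - 1)) = n powr (x - 1)\<close>. Two evaluations of the limit of
  \<open>(1 - t) powr x\<close> times the generating function as \<open>t\<close> tends to 1 are then compared: the Abelian
  theorem and the regularised Euler product. The restriction to \<open>0 < x \<le> 1\<close> makes all coefficients
  lie between 0 and 1.
\<close>

lemma mod_poisson_limit_at_real:
  fixes B :: "'a :: {field, finite} poly \<Rightarrow> 'w \<Rightarrow> nat" and x :: real
  assumes conv: "mod_poisson_convergent (uniform_monic :: nat \<Rightarrow> 'a poly measure)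
             (\<lambda>_. omega_poly) (\<lambda>n. ln (real n)) \<Phi>"
    and B: "bernoulli_model M B" and x: "0 < x" "x \<le> 1"
  shows "\<Phi> (of_real x) =
    exp (of_real (mertens_kappa TYPE('a)) * (of_real x - 1)) * rGamma (of_real x) *
    Phi_model TYPE('a) (of_real x)"
proof -
  let ?a = "mean_power_omega TYPE('a) x"
  have ratio: "\<forall>\<^sub>F n in sequentially.
      poisson_ratio (uniform_monic n :: 'a poly measure) omega_poly (ln (real n)) (of_real x) =
      of_real (?a n / real n powr (x - 1))"
    using eventually_ge_at_top[of 2]
  proof eventually_elim
    case (elim n)
    then have "ln (real n) > 0" by simp
    moreover have "exp (ln (real n) * (x - 1)) = real n powr (x - 1)"
      using elim by (simp add: powr_def mult.commute)
    then have "exp (complex_of_real (ln (real n)) * (of_real x - 1)) = of_real (real n powr (x - 1))"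
      by (metis exp_of_real of_real_1 of_real_diff of_real_mult)
    ultimately show ?case
      by (simp add: poisson_ratio_def expectation_poisson_power uniform_monic_expectation mean_power_omega_def)
  qed
  have lim: "(\<lambda>n. complex_of_real (?a n / real n powr (x - 1))) \<longlonglongrightarrow> \<Phi> (of_real x)"
    by (rule Lim_transform_eventually[OF mod_poisson_convergent_tendsto[OF conv] ratio])
  define c where "c = Re (\<Phi> (of_real x))"
  have c: "(\<lambda>n. ?a n / real n powr (x - 1)) \<longlonglongrightarrow> c"
    using tendsto_Re[OF lim] by (simp add: c_def)
  have \<Phi>: "\<Phi> (of_real x) = of_real c"
    by (rule LIMSEQ_unique[OF lim tendsto_of_real[OF c]])
  have "((\<lambda>t. (\<Sum>n. ?a n * t ^ n) * (1 - t) powr x) \<longlongrightarrow> c * Gamma x) (at_left 1)"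
    using x by (intro abel_power_singularity c summable_mean_power_omega) auto
  then have "(\<lambda>N. regular_product TYPE('a) x N 1) \<longlonglongrightarrow> c * Gamma x"
    using x by (intro regular_product_at_1_eq_limit) auto
  from LIMSEQ_unique[OF tendsto_of_real[OF this] regular_product_at_1_tendsto_model[OF B]]
  have eq: "complex_of_real (c * Gamma x) =
    exp (of_real (mertens_kappa TYPE('a)) * (of_real x - 1)) * Phi_model TYPE('a) (of_real x)" .
  have "complex_of_real (Gamma x) \<noteq> 0" using Gamma_real_pos[OF x(1)] by simp
  then have "\<Phi> (of_real x) = of_real (c * Gamma x) * rGamma (of_real x)"
    by (simp add: \<Phi> rGamma_inverse_Gamma Gamma_complex_of_real)
  then show ?thesis unfolding eq by (simp only: mult_ac)
qed

text \<open>
  The definition asks only for a continuous limiting function. If the generating functions are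
  entire, then so are the quotients, since the one of a Poisson variable is an exponential, and
  Weierstrass's theorem on locally uniform limits applies.
\<close>

lemma mod_poisson_limit_holomorphic:
  assumes conv: "mod_poisson_convergent M X \<gamma> \<Phi>"
    and hol: "\<And>n. (\<lambda>z. \<integral>w. z ^ X n w \<partial>M n) holomorphic_on UNIV"
  shows "\<Phi> holomorphic_on UNIV"
proof -
  have "\<exists>r>0. \<Phi> holomorphic_on ball z r" for z
  proof -
    obtain r where r: "r > 0" and
      u: "uniform_limit (ball z r) (\<lambda>n. poisson_ratio (M n) (X n) (\<gamma> n)) \<Phi> sequentially"
      using conv unfolding mod_poisson_convergent_def by blast
    have pos: "\<forall>\<^sub>F n in sequentially. \<gamma> n > 0" using conv by (simp add: mod_poisson_convergent_def)
    have "\<forall>\<^sub>F n in sequentially. poisson_ratio (M n) (X n) (\<gamma> n) holomorphic_on UNIV"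
      using pos
    proof eventually_elim
      case (elim n)
      show ?case
        unfolding poisson_ratio_def[abs_def] expectation_poisson_power[OF elim]
        by (intro holomorphic_intros hol) auto
    qed
    then have "\<forall>\<^sub>F n in sequentially. continuous_on (cball z (r / 2)) (poisson_ratio (M n) (X n) (\<gamma> n)) \<and>
        poisson_ratio (M n) (X n) (\<gamma> n) holomorphic_on ball z (r / 2)"
      by eventually_elim (meson holomorphic_on_imp_continuous_on holomorphic_on_subset subset_UNIV)
    moreover have "cball z (r / 2) \<subseteq> ball z r" using r by auto
    then have "uniform_limit (cball z (r / 2)) (\<lambda>n. poisson_ratio (M n) (X n) (\<gamma> n)) \<Phi> sequentially"
      using u uniform_limit_on_subset by blast
    ultimately have "\<Phi> holomorphic_on ball z (r / 2)"
      by (rule holomorphic_uniform_limit) auto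
    then show ?thesis using r by (intro exI[of _ "r / 2"]) auto
  qed
  then have "\<Phi> field_differentiable at z" for z
    by (meson centre_in_ball holomorphic_on_imp_differentiable_at open_ball)
  then show ?thesis by (simp add: holomorphic_on_def field_differentiable_at_within)
qed

theorem theorem5p2:
  fixes \<Phi> :: "complex \<Rightarrow> complex"
    and M :: "'w measure" and B :: "'a :: {field, finite} poly \<Rightarrow> 'w \<Rightarrow> nat"
  assumes "mod_poisson_convergent (uniform_monic :: nat \<Rightarrow> 'a poly measure)
             (\<lambda>_. omega_poly) (\<lambda>n. ln (real n)) \<Phi>"
    and "mod_poisson_relative_error (uniform_monic :: nat \<Rightarrow> 'a poly measure)
             (\<lambda>_. omega_poly) (\<lambda>n. ln (real n)) \<Phi>"
    and "bernoulli_model M B"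
  shows "\<exists>\<kappa>::real. \<forall>x. \<Phi> x = exp (of_real \<kappa> * (x - 1)) / Gamma x * Phi_model TYPE('a) x"
proof (intro exI[of _ "mertens_kappa TYPE('a)"] allI)
  fix z :: complex
  define \<kappa> where "\<kappa> = mertens_kappa TYPE('a)"
  define \<Psi> where "\<Psi> w = exp (of_real \<kappa> * (w - 1)) * rGamma w * Phi_model TYPE('a) w" for w
  have \<Phi>_hol: "\<Phi> holomorphic_on UNIV"
    by (rule mod_poisson_limit_holomorphic[OF assms(1)])
      (auto simp: uniform_monic_expectation intro!: holomorphic_intros)
  have model_hol: "Phi_model TYPE('a) holomorphic_on UNIV"
    using poly_abs_ge_1
    by (intro mod_poisson_limit_holomorphic[OF omega_model_mod_poisson[OF assms(3)]])
      (auto simp: bernoulli_model_expectation(1)[OF assms(3)] poly_abs_def intro!: holomorphic_intros)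
  have "\<Psi> holomorphic_on UNIV"
    unfolding \<Psi>_def by (intro holomorphic_intros model_hol)
  then have diff_hol: "(\<lambda>w. \<Phi> w - \<Psi> w) holomorphic_on UNIV"
    by (intro holomorphic_on_diff \<Phi>_hol)
  have "\<Phi> z - \<Psi> z = 0"
  proof (rule analytic_continuation[OF diff_hol open_UNIV connected_UNIV])
    \<comment> \<open>Both sides are entire, so that 0 may serve as accumulation point although it is a pole of \<open>Gamma\<close>.\<close>
    show "(0 :: complex) islimpt of_real ` {0<..1::real}"
    proof (rule islimpt_sequential[THEN iffD2], intro exI conjI allI)
      show "(\<lambda>n. complex_of_real (1 / real (Suc n))) \<longlonglongrightarrow> 0"
        using tendsto_of_real[OF LIMSEQ_inverse_real_of_nat, where 'a = complex]
        by (simp add: inverse_eq_divide)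
      show "complex_of_real (1 / real (Suc n)) \<in> of_real ` {0<..1} - {0}" for n
        by (auto intro!: imageI simp del: of_nat_Suc of_real_divide)
    qed
    show "\<Phi> w - \<Psi> w = 0" if "w \<in> of_real ` {0<..1::real}" for w
      using that mod_poisson_limit_at_real[OF assms(1,3)] by (auto simp: \<Psi>_def \<kappa>_def)
  qed auto
  then show "\<Phi> z = exp (of_real (mertens_kappa TYPE('a)) * (z - 1)) / Gamma z * Phi_model TYPE('a) z"
    by (simp add: \<Psi>_def \<kappa>_def Gamma_def divide_inverse)
qed

end
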